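(* Let $M$ and $N$ be bipersistence modules over a finite field $\mathbb{K}$ with finite presentations $P^M$ and $P^N$, and suppose that $d_B(M^\ell,N^\ell)<\infty$ for every slice $\ell$. If all row and column grades of $P^M$ and $P^N$ lie in $\mathbb{Q}^2$, then the matching distance $d_{\mathrm{match}}(M,N)$ is a rational number.
   Context: Let $\mathbb{K}$ be a fixed finite field. For $d\in\{1,2\}$, equip $\mathbb{R}^d$ with the product order ($p\le q$ iff $p_x\le q_x$ and $p_y\le q_y$ for $d=2$). A persistence module ($d=1$), resp. bipersistence module ($d=2$), is a functor from the poset $\mathbb{R}^d$ to $\mathbb{K}$-vector spaces: spaces $M_p$ and maps $M_{p\to q}:M_p\to M_q$ for $p\le q$. Finite presentation: a $k\times m$ matrix $P$ over $\mathbb{K}$ whose rows and columns are each labeled by a grade $\mathrm{gr}(-)\in\mathbb{R}^d$ such that $P_{ij}\ne0$ implies $\mathrm{gr}(\mathrm{row}_i)\le \mathrm{gr}(\mathrm{col}_j)$. It defines a module $M^P$ by $M^P_x=\mathrm{span}\{e_i\mid \mathrm{gr}(\mathrm{row}_i)\le x\}/\mathrm{span}\{\mathrm{col}_j\mid \mathrm{gr}(\mathrm{col}_j)\le x\}$, where $e_1,\dots,e_k$ is the standard basis of $\mathbb{K}^k$, with maps induced by inclusions. $P$ is a presentation of $N$ if $N\cong M^P$. Persistence diagram: for a finitely presented persistence module $M$ over $\mathbb{R}$, $D(M)$ is the finite multiset of pairs $(b,d)\in\mathbb{R}\times(\mathbb{R}\cup\{\infty\})$, $b<d$, such that $M$ is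 isomorphic to the direct sum of the interval modules supported on $[b,d)$. Bottleneck distance: a matching between diagrams $D_1,D_2$ is a bijection $\sigma:D_1'\to D_2'$ with $D_i'\subseteq D_i$ (as multisets). Its cost is $\max(A,B)$ with $A=\max\{\max(|a-c|,|b-d|)\mid (a,b)\in D_1',\ \sigma(a,b)=(c,d)\}$ and $B=\max\{(b-a)/2\mid (a,b)\in(D_1\setminus D_1')\cup(D_2\setminus D_2')\}$, where $\infty-\infty=0$ and the maximum of the empty set is $0$. $d_B(D_1,D_2)$ is the minimal cost of a matching, and $d_B(M,N):=d_B(D(M),D(N))$. Slices: a slice is a line $\ell: y=sx+t$ with $s>0$, $t\in\mathbb{R}$. It is parameterized isometrically by $\lambda(x)=\left(\frac{x}{\sqrt{1+s^2}},\frac{sx}{\sqrt{1+s^2}}+t\right)$. For a bipersistence module $M$, the slice module $M^\ell$ is the persistence module $M^\ell_x:=M_{\lambda(x)}$ with the induced maps. The weight is $w(\ell)=\frac{1}{\sqrt{1+s^2}}$ if $s\ge1$ and $w(\ell)=\frac{1}{\sqrt{1+1/s^2}}$ if $0<s<1$. Matching distance: $d_{\mathrm{match}}(M,N):=\sup_{\ell} w(\ell)\, d_B(M^\ell,N^\ell)$, the supremum over all slices. *)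

theory Defs
  imports
    "Jordan_Normal_Form.VS_Connect"
    "HOL-Algebra.QuotRing"
    "HOL-Library.Product_Order"
    "HOL-Library.Extended_Real"
begin

section \<open>Persistence modules over a poset\<close>

text \<open>
  The ground field is a type \<open>'k\<close> of class \<^class>\<open>field\<close>, seen as
  the HOL-Algebra ring \<^term>\<open>class_ring\<close>. A functor from the poset \<open>'p\<close> to vector spaces
  is given by its spaces and transition maps; only \<open>pmap M p q\<close> with \<open>p \<le> q\<close>, restricted to the
  carrier of \<open>space M p\<close>, is meaningful. Persistence modules are the case \<open>'p = real\<close>;
  bipersistence modules are the case \<open>'p = real \<times> real\<close>, ordered componentwise by
  \<^theory>\<open>HOL-Library.Product_Order\<close>.
\<close>

record ('p, 'k, 'v) pmod =
  space :: "'p \<Rightarrow> ('k, 'v) module"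
  pmap :: "'p \<Rightarrow> 'p \<Rightarrow> 'v \<Rightarrow> 'v"

locale persistence_module =
  fixes M :: "('p::order, 'k::field, 'v) pmod"
  assumes vectorspace_space: "vectorspace class_ring (space M p)"
    and linear_pmap: "p \<le> q \<Longrightarrow> linear_map class_ring (space M p) (space M q) (pmap M p q)"
    and pmap_id: "v \<in> carrier (space M p) \<Longrightarrow> pmap M p p v = v"
    and pmap_comp: "p \<le> q \<Longrightarrow> q \<le> r \<Longrightarrow> v \<in> carrier (space M p) \<Longrightarrow>
      pmap M q r (pmap M p q v) = pmap M p r v"

definition pmod_iso ::
  "('p::order, 'k::field, 'v) pmod \<Rightarrow> ('p, 'k, 'w) pmod \<Rightarrow> bool" (infix \<open>\<cong>\<^sub>p\<close> 50) where
  "M \<cong>\<^sub>p N \<longleftrightarrow> (\<exists>\<phi>.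
     (\<forall>p. linear_map class_ring (space M p) (space N p) (\<phi> p) \<and>
          bij_betw (\<phi> p) (carrier (space M p)) (carrier (space N p))) \<and>
     (\<forall>p q. p \<le> q \<longrightarrow>
        (\<forall>v \<in> carrier (space M p). \<phi> q (pmap M p q v) = pmap N p q (\<phi> p v))))"


section \<open>Finite presentations\<close>

text \<open>Only \<open>row_gr P i\<close> for row indices \<open>i\<close> and \<open>col_gr P j\<close> for column indices \<open>j\<close>
  of \<open>pmat P\<close> are meaningful.\<close>

record ('p, 'k) presentation =
  pmat :: "'k mat"
  row_gr :: "nat \<Rightarrow> 'p"
  col_gr :: "nat \<Rightarrow> 'p"

definition valid_presentation :: "('p::order, 'k::field) presentation \<Rightarrow> bool" where
  "valid_presentation P \<longleftrightarrow>
     (\<forall>i < dim_row (pmat P). \<forall>j < dim_col (pmat P).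
        pmat P $$ (i, j) \<noteq> 0 \<longrightarrow> row_gr P i \<le> col_gr P j)"

text \<open>The quotient of a module by a submodule, on cosets; this is the module counterpart of
  \<^const>\<open>FactRing\<close>. The ring multiplication fields of module records are irrelevant.\<close>

definition quotient_module :: "('k, 'v) module \<Rightarrow> 'v set \<Rightarrow> ('k, 'v set) module" where
  "quotient_module V N =
     \<lparr>carrier = a_rcosets\<^bsub>V\<^esub> N, mult = undefined, one = undefined,
      zero = N, add = set_add V,
      smult = (\<lambda>a X. \<Union>v\<in>X. N +>\<^bsub>V\<^esub> (a \<odot>\<^bsub>V\<^esub> v))\<rparr>"

abbreviation pres_ambient :: "('p, 'k::field) presentation \<Rightarrow> ('k, 'k vec) module" where
  "pres_ambient P \<equiv> module_vec TYPE('k) (dim_row (pmat P))"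

definition pres_gens :: "('p::order, 'k::field) presentation \<Rightarrow> 'p \<Rightarrow> 'k vec set" where
  "pres_gens P x = LinearCombinations.module.span class_ring (pres_ambient P)
     {unit_vec (dim_row (pmat P)) i | i. i < dim_row (pmat P) \<and> row_gr P i \<le> x}"

definition pres_rels :: "('p::order, 'k::field) presentation \<Rightarrow> 'p \<Rightarrow> 'k vec set" where
  "pres_rels P x = LinearCombinations.module.span class_ring (pres_ambient P)
     {col (pmat P) j | j. j < dim_col (pmat P) \<and> col_gr P j \<le> x}"

text \<open>The map induced by inclusion sends the coset of \<open>v\<close> at \<open>x\<close> to the coset of \<open>v\<close> at \<open>y\<close>.\<close>

definition presented_module ::
  "('p::order, 'k::field) presentation \<Rightarrow> ('p, 'k, 'k vec set) pmod" where
  "presented_module P =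
     \<lparr>space = (\<lambda>x. quotient_module
        ((pres_ambient P)\<lparr>carrier := pres_gens P x\<rparr>) (pres_rels P x)),
      pmap = (\<lambda>x y X. \<Union>v\<in>X. pres_rels P y +>\<^bsub>pres_ambient P\<^esub> v)\<rparr>"

definition presents ::
  "('p::order, 'k::field) presentation \<Rightarrow> ('p, 'k, 'v) pmod \<Rightarrow> bool" where
  "presents P N \<longleftrightarrow> valid_presentation P \<and> N \<cong>\<^sub>p presented_module P"


section \<open>Persistence diagrams\<close>

definition interval_module :: "real \<Rightarrow> ereal \<Rightarrow> (real, 'k::field, 'k) pmod" where
  "interval_module b d =
     \<lparr>space = (\<lambda>x.
        \<lparr>carrier = (if b \<le> x \<and> ereal x < d then UNIV else {0}),
         mult = (*), one = 1, zero = 0, add = (+), smult = (*)\<rparr>),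
      pmap = (\<lambda>x y v. if b \<le> x \<and> ereal y < d then v else 0)\<rparr>"

text \<open>The direct sum of a family indexed by a finite set \<open>I\<close>, as a product.\<close>

definition pmod_sum ::
  "'i set \<Rightarrow> ('i \<Rightarrow> ('p, 'k, 'v) pmod) \<Rightarrow> ('p, 'k, 'i \<Rightarrow> 'v) pmod" where
  "pmod_sum I M =
     \<lparr>space = (\<lambda>p.
        \<lparr>carrier = (\<Pi>\<^sub>E i\<in>I. carrier (space (M i) p)),
         mult = undefined, one = undefined,
         zero = (\<lambda>i\<in>I. \<zero>\<^bsub>space (M i) p\<^esub>),
         add = (\<lambda>f g. \<lambda>i\<in>I. f i \<oplus>\<^bsub>space (M i) p\<^esub> g i),
         smult = (\<lambda>a f. \<lambda>i\<in>I. a \<odot>\<^bsub>space (M i) p\<^esub> f i)\<rparr>),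
      pmap = (\<lambda>p q f. \<lambda>i\<in>I. pmap (M i) p q (f i))\<rparr>"

text \<open>The direct sum over a multiset of intervals is taken over an enumeration of the multiset as a
  list.\<close>

definition is_diagram :: "(real, 'k::field, 'v) pmod \<Rightarrow> (real \<times> ereal) multiset \<Rightarrow> bool" where
  "is_diagram M D \<longleftrightarrow> (\<forall>(b, d) \<in># D. ereal b < d) \<and>
     (\<exists>xs. mset xs = D \<and>
        M \<cong>\<^sub>p pmod_sum {..<length xs} (\<lambda>i. interval_module (fst (xs ! i)) (snd (xs ! i))))"

definition diagram :: "(real, 'k::field, 'v) pmod \<Rightarrow> (real \<times> ereal) multiset" where
  "diagram M = (THE D. is_diagram M D)"


section \<open>Bottleneck distance\<close>

text \<open>A bijection between sub-multisets \<open>D1'\<close> of \<open>D1\<close> and \<open>D2'\<close> of \<open>D2\<close> is encoded as the multiset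
  of its matched pairs, so that \<open>D1'\<close> and \<open>D2'\<close> are its two projections.\<close>

type_synonym matching = "((real \<times> ereal) \<times> (real \<times> ereal)) multiset"

definition is_matching ::
  "(real \<times> ereal) multiset \<Rightarrow> (real \<times> ereal) multiset \<Rightarrow> matching \<Rightarrow> bool" where
  "is_matching D1 D2 \<sigma> \<longleftrightarrow> image_mset fst \<sigma> \<subseteq># D1 \<and> image_mset snd \<sigma> \<subseteq># D2"

text \<open>On \<^typ>\<open>ereal\<close>, \<open>\<infinity> - \<infinity> = \<infinity>\<close>, whereas here \<open>\<infinity> - \<infinity>\<close> is to be \<open>0\<close>.\<close>

definition endpoint_dist :: "ereal \<Rightarrow> ereal \<Rightarrow> ereal" where
  "endpoint_dist b d = (if b = d then 0 else \<bar>b - d\<bar>)"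

text \<open>Inserting \<open>0\<close> makes the maximum of the empty set \<open>0\<close>; all other values are nonnegative.\<close>

definition matched_cost :: "matching \<Rightarrow> ereal" where
  "matched_cost \<sigma> = Max (insert 0
     ((\<lambda>((a, b), (c, d)). max (ereal \<bar>a - c\<bar>) (endpoint_dist b d)) ` set_mset \<sigma>))"

definition unmatched_cost ::
  "(real \<times> ereal) multiset \<Rightarrow> (real \<times> ereal) multiset \<Rightarrow> matching \<Rightarrow> ereal" where
  "unmatched_cost D1 D2 \<sigma> = Max (insert 0
     ((\<lambda>(a, b). (b - ereal a) / 2) `
        set_mset ((D1 - image_mset fst \<sigma>) + (D2 - image_mset snd \<sigma>))))"

definition matching_cost ::
  "(real \<times> ereal) multiset \<Rightarrow> (real \<times> ereal) multiset \<Rightarrow> matching \<Rightarrow> ereal" where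
  "matching_cost D1 D2 \<sigma> = max (matched_cost \<sigma>) (unmatched_cost D1 D2 \<sigma>)"

text \<open>The infimum is a minimum: there are only finitely many matchings, among them the empty one.\<close>

definition bottleneck_diagrams ::
  "(real \<times> ereal) multiset \<Rightarrow> (real \<times> ereal) multiset \<Rightarrow> ereal" where
  "bottleneck_diagrams D1 D2 = (INF \<sigma> \<in> {\<sigma>. is_matching D1 D2 \<sigma>}. matching_cost D1 D2 \<sigma>)"

definition bottleneck_dist ::
  "(real, 'k::field, 'v) pmod \<Rightarrow> (real, 'k, 'w) pmod \<Rightarrow> ereal" where
  "bottleneck_dist M N = bottleneck_diagrams (diagram M) (diagram N)"


section \<open>Slices and the matching distance\<close>

text \<open>The slice \<open>y = s x + t\<close> is given by the pair \<open>(s, t)\<close>, with \<open>s > 0\<close>.\<close>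

definition slices :: "(real \<times> real) set" where
  "slices = {(s, t). s > 0}"

fun slice_point :: "real \<times> real \<Rightarrow> real \<Rightarrow> real \<times> real" where
  "slice_point (s, t) x = (x / sqrt (1 + s\<^sup>2), s * x / sqrt (1 + s\<^sup>2) + t)"

definition slice_module ::
  "(real \<times> real, 'k, 'v) pmod \<Rightarrow> real \<times> real \<Rightarrow> (real, 'k, 'v) pmod" where
  "slice_module M l =
     \<lparr>space = (\<lambda>x. space M (slice_point l x)),
      pmap = (\<lambda>x y. pmap M (slice_point l x) (slice_point l y))\<rparr>"

fun slice_weight :: "real \<times> real \<Rightarrow> real" where
  "slice_weight (s, t) =
     (if s \<ge> 1 then 1 / sqrt (1 + s\<^sup>2) else 1 / sqrt (1 + 1 / s\<^sup>2))"

definition matching_dist ::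
  "(real \<times> real, 'k::field, 'v) pmod \<Rightarrow> (real \<times> real, 'k, 'w) pmod \<Rightarrow> ereal" where
  "matching_dist M N =
     (SUP l \<in> slices. ereal (slice_weight l) *
        bottleneck_dist (slice_module M l) (slice_module N l))"

end

theory Submission
  imports Defs "HOL-Library.Product_Plus" "HOL-Library.Infinite_Set"
begin

text \<open>
  On a slice \<open>y = s x + t\<close>, a presentation of a bipersistence module becomes a presentation over \<open>\<real>\<close> in which
  each grade \<open>p\<close> is replaced by the point \<open>push (s, t) p\<close> where the slice enters the quadrant above \<open>p\<close>. Column
  reduction turns it into a barcode (\<open>adapted_coordinates\<close>, \<open>is_diagram_of_splits\<close>); the diagram is
  well defined because, over a finite field, the barcode is determined by the sizes of the images of
  the transition maps (\<open>diagram_eqI\<close>). The pairing of rows with columns that the reduction finds depends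
  only on the order of the pushed grades (\<open>splits_transfer\<close>). So, as long as this order does not change,
  the two diagrams are fixed symbolic diagrams with moving endpoints, and the bottleneck distance is a
  difference of two pushed grades, half such a difference, or 0 (\<open>bottleneck_slice_cell\<close>).

  The weight of a slice is chosen so that it cancels the square roots: with \<open>(a, c) = (1 / s, t / s)\<close> for
  \<open>s \<ge> 1\<close> and \<open>(a, c) = (s, - t)\<close> for \<open>s < 1\<close>, the weighted push is, up to a constant, a maximum of two affine
  functions of \<open>(a, c)\<close> whose coefficients are coordinates of grades (\<open>push_slice_of\<close>). Hence the
  weighted bottleneck distance is piecewise affine with rational coefficients, on finitely many cells
  cut out by rational affine forms. Its supremum is rational (\<open>rational_Sup\<close>): if a limit point of a
  maximising sequence had irrational coordinates, one could apply a \<open>\<rat>\<close>-linear projection \<open>\<real> \<longrightarrow> \<rat>\<close> to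
  them and move towards and away from the result without leaving the cells, so the affine form in
  question cannot change in that direction; its value is thus fixed by the projection.
\<close>

section \<open>Suprema of piecewise rational affine functions\<close>

text \<open>A projection of \<open>\<real>\<close> onto \<open>\<rat>\<close>, linear over \<open>\<rat>\<close>. It commutes with affine forms that have rational
  coefficients, so it preserves every rational linear equation. It is wildly discontinuous, hence
  it cannot preserve inequalities by itself.\<close>

lemma rational_projection:
  obtains \<pi> :: "real \<Rightarrow> rat"
  where "\<And>x y. \<pi> (x + y) = \<pi> x + \<pi> y" "\<And>q x. \<pi> (of_rat q * x) = q * \<pi> x" "\<pi> 1 = 1"
proof -
  interpret vector_space_pair "\<lambda>(q::rat) (x::real). of_rat q * x" "(*) :: rat \<Rightarrow> rat \<Rightarrow> rat"
    by unfold_locales (auto simp: algebra_simps of_rat_add of_rat_mult)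
  have "vs1.independent {1::real}"
    using vs1.independent_insert[of 1 "{}"] vs1.independent_empty by simp
  then obtain g where g: "Vector_Spaces.linear (\<lambda>(q::rat) (x::real). of_rat q * x) (*) g" "g 1 = (1::rat)"
    using linear_independent_extend[of "{1}" "\<lambda>_. 1"] by auto
  interpret g: Vector_Spaces.linear "\<lambda>(q::rat) (x::real). of_rat q * x" "(*)" g by (rule g)
  show ?thesis using that[of g] g.add g.scale g(2) by blast
qed

definition aff :: "rat \<times> rat \<times> rat \<Rightarrow> real \<times> real \<Rightarrow> real" where
  "aff g z = (case g of (g0, g1, g2) \<Rightarrow> of_rat g0 + of_rat g1 * fst z + of_rat g2 * snd z)"

lemma aff_diff: "aff (g - h) z = aff g z - aff h z"
  by (cases g; cases h) (simp add: aff_def of_rat_diff algebra_simps)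

lemma bounded_seq_plane:
  fixes z :: "nat \<Rightarrow> real \<times> real"
  assumes "\<And>n. \<bar>fst (z n)\<bar> \<le> B \<and> \<bar>snd (z n)\<bar> \<le> B"
  obtains r a c where "strict_mono (r :: nat \<Rightarrow> nat)"
    "(\<lambda>n. fst (z (r n))) \<longlonglongrightarrow> a" "(\<lambda>n. snd (z (r n))) \<longlonglongrightarrow> c"
proof -
  have conv: "\<exists>r L. strict_mono (r :: nat \<Rightarrow> nat) \<and> (\<lambda>n. X (r n)) \<longlonglongrightarrow> L"
    if "\<And>n. \<bar>X n\<bar> \<le> B" for X :: "nat \<Rightarrow> real"
  proof -
    obtain r :: "nat \<Rightarrow> nat" where r: "strict_mono r" "monoseq (\<lambda>n. X (r n))" using seq_monosub by blast
    have "Bseq (\<lambda>n. X (r n))" by (rule BseqI'[where K = B]) (use that in auto)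
    then show ?thesis using r Bseq_monoseq_convergent unfolding convergent_def by blast
  qed
  obtain r a where r: "strict_mono (r :: nat \<Rightarrow> nat)" "(\<lambda>n. fst (z (r n))) \<longlonglongrightarrow> a"
    using conv[of "\<lambda>n. fst (z n)"] assms by blast
  obtain r' c where r': "strict_mono (r' :: nat \<Rightarrow> nat)" "(\<lambda>n. snd (z (r (r' n)))) \<longlonglongrightarrow> c"
    using conv[of "\<lambda>n. snd (z (r n))"] assms by blast
  show ?thesis
    using that[of "r \<circ> r'" a c] r r' LIMSEQ_subseq_LIMSEQ[OF r(2) r'(1)] strict_mono_o[OF r(1) r'(1)]
    by (auto simp: o_def)
qed

text \<open>The cell hypothesis says that \<open>F\<close> is bounded below, on the sign cell
  of each point, by the rational affine form which it equals at that point. Take \<open>z\<^sub>n\<close> with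
  \<open>F z\<^sub>n \<longrightarrow> S = Sup\<close>, where by the pigeonhole principle one form \<open>u\<close> computes every \<open>F z\<^sub>n\<close>, and let
  \<open>z\<^sub>n \<longrightarrow> (a, c)\<close>, so that \<open>u (a, c) = S\<close>. Let \<open>\<delta> = (\<pi> a - a, \<pi> c - c)\<close>. A form of \<open>\<Lambda>\<close> that vanishes at
  \<open>(a, c)\<close> also vanishes at \<open>(\<pi> a, \<pi> c)\<close>, so it is constant along \<open>\<delta>\<close>; a form that does not vanish there
  keeps its sign near \<open>(a, c)\<close>. Therefore \<open>z\<^sub>n \<plusminus> \<epsilon> \<delta>\<close> lie in the cell of \<open>z\<^sub>n\<close> for large \<open>n\<close>, and in the limit
  \<open>S \<plusminus> \<epsilon> (\<pi> S - S) \<le> S\<close>. This forces \<open>\<pi> S = S\<close>, that is, \<open>S \<in> \<rat>\<close>.\<close>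

lemma rational_Sup:
  fixes F :: "real \<times> real \<Rightarrow> real"
  assumes fin: "finite \<Lambda>" "finite W" and ne: "D \<noteq> {}"
    and cell: "\<And>z. z \<in> D \<Longrightarrow> \<exists>w\<in>W. F z = aff w z \<and>
      (\<forall>z'. (\<forall>g\<in>\<Lambda>. sgn (aff g z') = sgn (aff g z)) \<longrightarrow> z' \<in> D \<and> aff w z' \<le> F z')"
    and box: "\<And>z. z \<in> D \<Longrightarrow> \<exists>y\<in>D. \<bar>fst y\<bar> \<le> B \<and> \<bar>snd y\<bar> \<le> B \<and> F z \<le> F y"
  shows "bdd_above (F ` D)" "Sup (F ` D) \<in> \<rat>"
proof -
  define C where "C = (\<Sum>w\<in>W. case w of (g0, g1, g2) \<Rightarrow> \<bar>of_rat g0\<bar> + \<bar>of_rat g1\<bar> * B + \<bar>of_rat g2\<bar> * B)"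
  have affC: "aff w y \<le> C" if "w \<in> W" "\<bar>fst y\<bar> \<le> B" "\<bar>snd y\<bar> \<le> B" for w y
  proof -
    have B: "B \<ge> 0" using that by linarith
    obtain g0 g1 g2 where w: "w = (g0, g1, g2)" by (cases w)
    have m: "of_rat g * x \<le> \<bar>of_rat g\<bar> * B" if "\<bar>x\<bar> \<le> B" for g and x :: real
      using abs_ge_self[of "of_rat g * x"] mult_left_mono[OF that abs_ge_zero[of "of_rat g :: real"]]
      by (simp add: abs_mult)
    have "aff w y \<le> \<bar>of_rat g0\<bar> + \<bar>of_rat g1\<bar> * B + \<bar>of_rat g2\<bar> * B"
      unfolding aff_def w using m[OF that(2), of g1] m[OF that(3), of g2]
      by (auto intro!: add_mono simp: of_rat_less_eq)
    also have "\<dots> \<le> C"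
      unfolding C_def
      using member_le_sum[OF that(1), of "\<lambda>w. case w of (g0, g1, g2) \<Rightarrow> \<bar>of_rat g0\<bar> + \<bar>of_rat g1\<bar> * B + \<bar>of_rat g2\<bar> * B"]
        fin(2) B by (auto simp: w)
    finally show ?thesis .
  qed
  have "F z \<le> C" if "z \<in> D" for z
    using box[OF that] cell affC by (metis order_trans)
  then show bdd: "bdd_above (F ` D)" by (rule bdd_aboveI2)
  define S where "S = Sup (F ` D)"
  have le_S: "F z \<le> S" if "z \<in> D" for z unfolding S_def using bdd that by (simp add: cSUP_upper)
  have "\<exists>y. y \<in> D \<and> \<bar>fst y\<bar> \<le> B \<and> \<bar>snd y\<bar> \<le> B \<and> S - 1 / Suc n < F y" for n
  proof -
    have "S - 1 / Suc n < Sup (F ` D)" by (simp add: S_def)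
    then obtain z where "z \<in> D" "S - 1 / Suc n < F z"
      using less_cSup_iff[of "F ` D"] ne bdd by auto
    then show ?thesis using box[of z] by force
  qed
  then obtain y where y: "\<And>n. y n \<in> D \<and> \<bar>fst (y n)\<bar> \<le> B \<and> \<bar>snd (y n)\<bar> \<le> B \<and> S - 1 / Suc n < F (y n)"
    by metis
  have "\<exists>w. \<forall>n. w n \<in> W \<and> F (y n) = aff (w n) (y n) \<and>
      (\<forall>z'. (\<forall>g\<in>\<Lambda>. sgn (aff g z') = sgn (aff g (y n))) \<longrightarrow> z' \<in> D \<and> aff (w n) z' \<le> F z')"
    using cell y by (intro choice) blast
  then obtain w where w: "\<And>n. w n \<in> W" "\<And>n. F (y n) = aff (w n) (y n)"
    "\<And>n z'. (\<And>g. g \<in> \<Lambda> \<Longrightarrow> sgn (aff g z') = sgn (aff g (y n))) \<Longrightarrow> z' \<in> D \<and> aff (w n) z' \<le> F z'"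
    by metis
  have "finite (range w)" using fin(2) w(1) by (metis finite_subset image_subsetI)
  then obtain n0 where "infinite {n. w n = w n0}"
    using pigeonhole_infinite[of UNIV w] by auto
  then obtain r :: "nat \<Rightarrow> nat" where r: "strict_mono r" "\<And>n. w (r n) = w n0"
    by (metis (mono_tags, lifting) infinite_enumerate mem_Collect_eq)
  obtain r' a c where r': "strict_mono (r' :: nat \<Rightarrow> nat)"
    and lima: "(\<lambda>n. fst (y (r (r' n)))) \<longlonglongrightarrow> a" and limc: "(\<lambda>n. snd (y (r (r' n)))) \<longlonglongrightarrow> c"
    using bounded_seq_plane[of "\<lambda>n. y (r n)" B] y by blast
  define x where "x n = y (r (r' n))" for n
  define u where "u = w n0"
  have lim: "(\<lambda>n. aff g (x n)) \<longlonglongrightarrow> aff g (a, c)" for g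
    using lima limc by (cases g) (auto simp: aff_def x_def intro!: tendsto_intros)
  have F_x: "F (x n) = aff u (x n)" for n using w(2)[of "r (r' n)"] r(2) by (simp add: x_def u_def)
  have S_eq: "aff u (a, c) = S"
  proof (rule antisym)
    have "aff u (x n) \<le> S" for n using le_S[of "x n"] y F_x by (simp add: x_def)
    then show "aff u (a, c) \<le> S" by (intro LIMSEQ_le_const2[OF lim]) blast
    have "(\<lambda>n. S - 1 / Suc (r (r' n))) \<longlonglongrightarrow> S - 0"
      using LIMSEQ_subseq_LIMSEQ[OF LIMSEQ_subseq_LIMSEQ[OF LIMSEQ_Suc[OF lim_inverse_n] r(1)] r']
      by (intro tendsto_intros) (simp add: o_def field_simps)
    moreover have "S - 1 / Suc (r (r' n)) \<le> aff u (x n)" for n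
      using y[of "r (r' n)"] F_x[of n] by (simp add: x_def)
    ultimately show "S \<le> aff u (a, c)"
      by (intro LIMSEQ_le[OF _ lim[of u], of _ S]) auto
  qed
  obtain \<pi> :: "real \<Rightarrow> rat" where \<pi>: "\<And>x y. \<pi> (x + y) = \<pi> x + \<pi> y"
      "\<And>q x. \<pi> (of_rat q * x) = q * \<pi> x" "\<pi> 1 = 1"
    using rational_projection by metis
  have \<pi>_rat: "\<pi> (of_rat q) = q" for q using \<pi>(2)[of q 1] \<pi>(3) by simp
  define \<delta> :: "real \<times> real" where "\<delta> = (of_rat (\<pi> a) - a, of_rat (\<pi> c) - c)"
  define lin where "lin g = of_rat (\<pi> (aff g (a, c))) - aff g (a, c)" for g
  have move: "aff g (fst z + t * fst \<delta>, snd z + t * snd \<delta>) = aff g z + t * lin g" for g z and t :: real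
  proof (cases g)
    case (fields g0 g1 g2)
    have "lin g = of_rat g1 * fst \<delta> + of_rat g2 * snd \<delta>"
      by (simp add: fields aff_def lin_def \<delta>_def \<pi> \<pi>_rat of_rat_add of_rat_mult right_diff_distrib)
    then show ?thesis by (simp add: fields aff_def algebra_simps)
  qed
  \<comment> \<open>So small that no form of \<open>\<Lambda>\<close> that is nonzero at the limit loses its sign; the summand 1 is there
    because \<open>lin g\<close> may be 0.\<close>
  define \<epsilon> where "\<epsilon> = Min (insert 1 ((\<lambda>g. \<bar>aff g (a, c)\<bar> / (\<bar>lin g\<bar> + 1) / 2) ` {g \<in> \<Lambda>. aff g (a, c) \<noteq> 0}))"
  have \<epsilon>: "\<epsilon> > 0" unfolding \<epsilon>_def using fin(1) by (auto simp: Min_gr_iff intro!: divide_pos_pos add_nonneg_pos)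
  have \<epsilon>_small: "\<epsilon> * \<bar>lin g\<bar> < \<bar>aff g (a, c)\<bar>" if "g \<in> \<Lambda>" "aff g (a, c) \<noteq> 0" for g
  proof -
    have "\<epsilon> \<le> \<bar>aff g (a, c)\<bar> / (\<bar>lin g\<bar> + 1) / 2"
      unfolding \<epsilon>_def by (rule Min_le) (use that fin in auto)
    then have "\<epsilon> * (\<bar>lin g\<bar> + 1) \<le> \<bar>aff g (a, c)\<bar> / 2" by (simp add: field_simps)
    then show ?thesis using \<epsilon> that(2) by (simp add: algebra_simps)
  qed
  have shift: "aff u (a, c) + t * lin u \<le> S" if t: "\<bar>t\<bar> = \<epsilon>" for t
  proof -
    define x' where "x' n = (fst (x n) + t * fst \<delta>, snd (x n) + t * snd \<delta>)" for n
    have "\<forall>\<^sub>F n in sequentially. sgn (aff g (x' n)) = sgn (aff g (x n))" if g: "g \<in> \<Lambda>" for g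
    proof (cases "aff g (a, c) = 0")
      case True
      then have "lin g = 0" using \<pi>_rat[of 0] by (simp add: lin_def)
      then show ?thesis by (simp add: x'_def move)
    next
      case False
      have lim': "(\<lambda>n. aff g (x' n)) \<longlonglongrightarrow> aff g (a, c) + t * lin g"
        unfolding x'_def move by (intro tendsto_intros lim)
      have small: "\<bar>t * lin g\<bar> < \<bar>aff g (a, c)\<bar>" using \<epsilon>_small[OF g False] t by (simp add: abs_mult)
      show ?thesis
      proof (cases "aff g (a, c) > 0")
        case True
        then have "\<forall>\<^sub>F n in sequentially. aff g (x' n) > 0" "\<forall>\<^sub>F n in sequentially. aff g (x n) > 0"
          using small by (intro order_tendstoD(1)[OF lim'] order_tendstoD(1)[OF lim]; linarith)+
        then show ?thesis by eventually_elim simp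
      next
        case neg: False
        then have "\<forall>\<^sub>F n in sequentially. aff g (x' n) < 0" "\<forall>\<^sub>F n in sequentially. aff g (x n) < 0"
          using small False by (intro order_tendstoD(2)[OF lim'] order_tendstoD(2)[OF lim]; linarith)+
        then show ?thesis by eventually_elim simp
      qed
    qed
    then have "\<forall>\<^sub>F n in sequentially. \<forall>g\<in>\<Lambda>. sgn (aff g (x' n)) = sgn (aff g (x n))"
      using fin(1) by (simp add: eventually_ball_finite)
    then have "\<forall>\<^sub>F n in sequentially. aff u (x n) + t * lin u \<le> S"
    proof eventually_elim
      case (elim n)
      then have "x' n \<in> D \<and> aff u (x' n) \<le> F (x' n)"
        using w(3)[of "x' n" "r (r' n)"] r(2) by (auto simp: u_def x_def)
      then show ?case using le_S[of "x' n"] by (simp add: x'_def move)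
    qed
    then show ?thesis
      by (intro tendsto_upperbound[of "\<lambda>n. aff u (x n) + t * lin u" _ sequentially]) (auto intro!: tendsto_intros lim)
  qed
  have "\<epsilon> * lin u \<le> 0" "\<epsilon> * lin u \<ge> 0" using shift[of \<epsilon>] shift[of "-\<epsilon>"] \<epsilon> S_eq by auto
  then have "lin u = 0" using \<epsilon> by (simp add: mult_le_0_iff zero_le_mult_iff)
  then have "of_rat (\<pi> S) = S" by (simp add: lin_def S_eq)
  then show "Sup (F ` D) \<in> \<rat>" unfolding S_def[symmetric] by (metis Rats_of_rat)
qed

section \<open>Uniqueness of persistence diagrams\<close>

lemma card_field_gt_1: "card (UNIV :: 'k::{field, finite} set) > 1"
proof -
  have "card {0, 1 :: 'k} \<le> card (UNIV :: 'k set)" by (rule card_mono) auto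
  then show ?thesis by simp
qed

text \<open>The rank function determines a barcode. After cancelling common bars, take the leftmost left
  endpoint \<open>b\<close> and the largest right endpoint \<open>d\<close> over it: for \<open>y\<close> just below \<open>d\<close>, only copies of \<open>(b, d)\<close> are
  born by \<open>b\<close> and alive at \<open>y\<close>.\<close>

lemma multiset_intervals_eqI:
  fixes D D' :: "(real \<times> ereal) multiset"
  assumes pos: "\<And>b d. (b, d) \<in># D \<Longrightarrow> ereal b < d" "\<And>b d. (b, d) \<in># D' \<Longrightarrow> ereal b < d"
    and eq: "\<And>x y. x \<le> y \<Longrightarrow> size {#(b, d) \<in># D. b \<le> x \<and> ereal y < d#} = size {#(b, d) \<in># D'. b \<le> x \<and> ereal y < d#}"
  shows "D = D'"
proof (rule ccontr)
  assume neq: "D \<noteq> D'"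
  define E E' where "E = D - D'" and "E' = D' - D"
  have split: "D = E + D \<inter># D'" "D' = E' + D \<inter># D'"
    by (auto simp: E_def E'_def multiset_eq_iff)
  have disj: "set_mset E \<inter> set_mset E' = {}"
    by (auto simp: E_def E'_def in_diff_count)
  define A where "A = set_mset E \<union> set_mset E'"
  have finA: "finite A" by (simp add: A_def)
  have neA: "A \<noteq> {}" using neq split unfolding A_def by (metis Un_empty set_mset_eq_empty_iff)
  have posA: "ereal b < d" if "(b, d) \<in> A" for b d
    using that pos unfolding A_def E_def E'_def by (auto dest: in_diffD)
  define b where "b = Min (fst ` A)"
  have b_min: "b \<le> b'" if "(b', d') \<in> A" for b' d'
    unfolding b_def by (rule Min_le) (use that finA in force)+
  have "b \<in> fst ` A" unfolding b_def by (rule Min_in) (use neA finA in auto)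
  then have ne: "{d. (b, d) \<in> A} \<noteq> {}" by auto
  have fin: "finite {d. (b, d) \<in> A}"
    by (rule finite_subset[of _ "snd ` A"]) (use finA in force)+
  define d where "d = Max {d. (b, d) \<in> A}"
  have dA: "(b, d) \<in> A" using Max_in[OF fin ne] by (simp add: d_def)
  have d_max: "d' \<le> d" if "(b, d') \<in> A" for d' unfolding d_def by (rule Max_ge) (use that fin in auto)
  define Q where "Q = insert (ereal b) {d'. (b, d') \<in> A \<and> d' < d}"
  have finQ: "finite Q" using fin by (simp add: Q_def)
  have "Max Q < d" using finQ posA[OF dA] by (subst Max_less_iff) (auto simp: Q_def)
  then obtain y where y: "Max Q < ereal y" "ereal y < d" using ereal_dense2 by blast
  have yQ: "q < ereal y" if "q \<in> Q" for q using Max_ge[OF finQ that] y(1) by simp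
  have b_le_y: "b \<le> y" using yQ[of "ereal b"] by (simp add: Q_def)
  have char: "b' \<le> b \<and> ereal y < d' \<longleftrightarrow> (b', d') = (b, d)" if "(b', d') \<in> A" for b' d'
    using that b_min[OF that] d_max yQ y by (force simp: Q_def)
  have "size {#(b', d') \<in># E. b' \<le> b \<and> ereal y < d'#} = size {#(b', d') \<in># E'. b' \<le> b \<and> ereal y < d'#}"
    using eq[OF b_le_y] arg_cong[OF split(1), of "\<lambda>D. size {#(b', d') \<in># D. b' \<le> b \<and> ereal y < d'#}"]
      arg_cong[OF split(2), of "\<lambda>D. size {#(b', d') \<in># D. b' \<le> b \<and> ereal y < d'#}"] by simp
  moreover have "{#(b', d') \<in># E. b' \<le> b \<and> ereal y < d'#} = {#z \<in># E. z = (b, d)#}"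
    by (rule filter_mset_cong) (use char in \<open>auto simp: A_def\<close>)
  moreover have "{#(b', d') \<in># E'. b' \<le> b \<and> ereal y < d'#} = {#z \<in># E'. z = (b, d)#}"
    by (rule filter_mset_cong) (use char in \<open>auto simp: A_def\<close>)
  ultimately have "count E (b, d) = count E' (b, d)" by (simp add: filter_eq_replicate_mset)
  then have "(b, d) \<in># E \<longleftrightarrow> (b, d) \<in># E'" by (metis not_in_iff)
  then show False using dA disj unfolding A_def by blast
qed

text \<open>Over a finite field the rank of a transition map can be read off from the number of elements of
  its image, which is visibly invariant under isomorphism.\<close>

lemma card_image_pmap_diagram:
  fixes M :: "(real, 'k::{field, finite}, 'v) pmod"
  assumes M: "persistence_module M" and D: "is_diagram M D" and xy: "x \<le> y"
  shows "card (pmap M x y ` carrier (space M x)) = card (UNIV :: 'k set) ^ size {#(b, d) \<in># D. b \<le> x \<and> ereal y < d#}"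
proof -
  interpret persistence_module M by (rule M)
  obtain xs where xs: "mset xs = D"
    and iso: "M \<cong>\<^sub>p pmod_sum {..<length xs} (\<lambda>i. interval_module (fst (xs ! i)) (snd (xs ! i)))"
    using D unfolding is_diagram_def by blast
  define I where "I = {..<length xs}"
  define N :: "(real, 'k, nat \<Rightarrow> 'k) pmod" where
    "N = pmod_sum I (\<lambda>i. interval_module (fst (xs ! i)) (snd (xs ! i)))"
  obtain \<phi> where bij: "\<And>p. bij_betw (\<phi> p) (carrier (space M p)) (carrier (space N p))"
    and nat: "\<And>v. v \<in> carrier (space M x) \<Longrightarrow> \<phi> y (pmap M x y v) = pmap N x y (\<phi> x v)"
    using iso xy unfolding pmod_iso_def N_def I_def by blast
  have cl: "pmap M x y ` carrier (space M x) \<subseteq> carrier (space M y)"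
    using linear_pmap[OF xy] by (auto simp: linear_map_def mod_hom_def mod_hom_axioms_def LinearCombinations.module_hom_def)
  have "card (pmap M x y ` carrier (space M x)) = card (\<phi> y ` pmap M x y ` carrier (space M x))"
    by (rule card_image[symmetric]) (use bij[of y] cl in \<open>auto simp: bij_betw_def intro: inj_on_subset\<close>)
  also have "\<phi> y ` pmap M x y ` carrier (space M x) = pmap N x y ` \<phi> x ` carrier (space M x)"
    using nat by (force simp: image_image)
  also have "\<phi> x ` carrier (space M x) = carrier (space N x)" using bij[of x] by (simp add: bij_betw_def)
  also have "pmap N x y ` carrier (space N x) =
     (\<Pi>\<^sub>E i\<in>I. if fst (xs ! i) \<le> x \<and> ereal y < snd (xs ! i) then UNIV else {0})" (is "_ = ?R")
  proof (intro equalityI subsetI)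
    fix f assume "f \<in> ?R"
    moreover have "ereal x < d" if "ereal y < d" for d using that xy by (meson ereal_less_eq(3) order_le_less_trans)
    ultimately have "f \<in> carrier (space N x)" "f = pmap N x y f"
      by (auto simp: N_def pmod_sum_def interval_module_def PiE_iff restrict_def extensional_def fun_eq_iff
          split: if_splits)
    then show "f \<in> pmap N x y ` carrier (space N x)" by blast
  qed (auto simp: N_def pmod_sum_def interval_module_def)
  also have "card ?R = (\<Prod>i\<in>I. if fst (xs ! i) \<le> x \<and> ereal y < snd (xs ! i) then card (UNIV :: 'k set) else 1)"
    unfolding I_def by (subst card_PiE) (auto intro!: prod.cong)
  also have "\<dots> = card (UNIV :: 'k set) ^ card {i \<in> I. fst (xs ! i) \<le> x \<and> ereal y < snd (xs ! i)}"
    by (simp add: prod.If_cases I_def Int_def)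
  also have "card {i \<in> I. fst (xs ! i) \<le> x \<and> ereal y < snd (xs ! i)} =
      length (filter (\<lambda>(b, d). b \<le> x \<and> ereal y < d) xs)"
    by (simp add: I_def length_filter_conv_card case_prod_beta)
  also have "\<dots> = size {#(b, d) \<in># D. b \<le> x \<and> ereal y < d#}"
    by (simp flip: xs mset_filter)
  finally show ?thesis .
qed

lemma diagram_eqI:
  fixes M :: "(real, 'k::{field, finite}, 'v) pmod"
  assumes M: "persistence_module M" and D: "is_diagram M D"
  shows "diagram M = D"
  unfolding diagram_def
proof (rule the_equality[of "is_diagram M", OF D])
  fix D' assume D': "is_diagram M D'"
  show "D' = D"
  proof (rule multiset_intervals_eqI)
    fix x y :: real assume "x \<le> y"
    then show "size {#(b, d) \<in># D'. b \<le> x \<and> ereal y < d#} = size {#(b, d) \<in># D. b \<le> x \<and> ereal y < d#}"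
      using card_image_pmap_diagram[OF M D] card_image_pmap_diagram[OF M D'] card_field_gt_1[where 'k = 'k]
      by (metis power_inject_exp)
  qed (use D D' in \<open>auto simp: is_diagram_def\<close>)
qed

section \<open>Column reduction\<close>

definition col_combs :: "'k::field mat \<Rightarrow> nat set \<Rightarrow> 'k vec set" where
  "col_combs A J = {u \<in> carrier_vec (dim_row A). \<exists>a. \<forall>i < dim_row A. u $ i = (\<Sum>j\<in>J. a j * A $$ (i, j))}"

lemma col_combs_empty: "col_combs A {} = {0\<^sub>v (dim_row A)}"
  by (auto simp: col_combs_def)

lemma col_combs_insert:
  assumes "finite J" "n \<notin> J" "n < dim_col A"
  shows "u \<in> col_combs A (insert n J) \<longleftrightarrow>
    u \<in> carrier_vec (dim_row A) \<and> (\<exists>b. u - b \<cdot>\<^sub>v col A n \<in> col_combs A J)"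
proof (intro iffI conjI)
  assume u: "u \<in> col_combs A (insert n J)"
  then show "u \<in> carrier_vec (dim_row A)" by (simp add: col_combs_def)
  obtain a where "\<forall>i < dim_row A. u $ i = (\<Sum>j\<in>insert n J. a j * A $$ (i, j))"
    using u by (auto simp: col_combs_def)
  then have "u - a n \<cdot>\<^sub>v col A n \<in> col_combs A J"
    using u assms by (auto simp: col_combs_def intro!: exI[of _ a])
  then show "\<exists>b. u - b \<cdot>\<^sub>v col A n \<in> col_combs A J" by blast
next
  assume "u \<in> carrier_vec (dim_row A) \<and> (\<exists>b. u - b \<cdot>\<^sub>v col A n \<in> col_combs A J)"
  then obtain b a where u: "u \<in> carrier_vec (dim_row A)"
    and a: "\<And>i. i < dim_row A \<Longrightarrow> (u - b \<cdot>\<^sub>v col A n) $ i = (\<Sum>j\<in>J. a j * A $$ (i, j))"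
    by (auto simp: col_combs_def)
  have "u $ i = (\<Sum>j\<in>insert n J. (a(n := b)) j * A $$ (i, j))" if "i < dim_row A" for i
  proof -
    have "(\<Sum>j\<in>J. (a(n := b)) j * A $$ (i, j)) = (\<Sum>j\<in>J. a j * A $$ (i, j))"
      using assms(2) by (intro sum.cong) auto
    then show ?thesis using a[OF that] that u assms by (simp add: algebra_simps)
  qed
  then show "u \<in> col_combs A (insert n J)" using u by (auto simp: col_combs_def)
qed

lemma vec_submoduleI:
  assumes "N \<subseteq> carrier_vec k" "0\<^sub>v k \<in> N" "\<And>u v. u \<in> N \<Longrightarrow> v \<in> N \<Longrightarrow> u + v \<in> N"
    "\<And>a u. u \<in> N \<Longrightarrow> a \<cdot>\<^sub>v u \<in> N"
  shows "submodule class_ring N (module_vec TYPE('k::field) k)"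
  using assms vec_module by (auto simp: submodule_def module_vec_simps)

text \<open>A span is characterised by closure and minimality, without reference to formal linear
  combinations.\<close>

lemma vec_span_eqI:
  fixes S N :: "'k::field vec set"
  assumes sub: "S \<subseteq> N" "N \<subseteq> carrier_vec k"
    and cl: "0\<^sub>v k \<in> N" "\<And>u v. u \<in> N \<Longrightarrow> v \<in> N \<Longrightarrow> u + v \<in> N" "\<And>a u. u \<in> N \<Longrightarrow> a \<cdot>\<^sub>v u \<in> N"
    and min: "\<And>u N'. u \<in> N \<Longrightarrow> S \<subseteq> N' \<Longrightarrow> 0\<^sub>v k \<in> N' \<Longrightarrow> N' \<subseteq> carrier_vec k \<Longrightarrow>
      (\<And>u v. u \<in> N' \<Longrightarrow> v \<in> N' \<Longrightarrow> u + v \<in> N') \<Longrightarrow> (\<And>a u. u \<in> N' \<Longrightarrow> a \<cdot>\<^sub>v u \<in> N') \<Longrightarrow> u \<in> N'"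
  shows "LinearCombinations.module.span class_ring (module_vec TYPE('k) k) S = N"
proof -
  interpret vec_space "TYPE('k)" k .
  have S: "S \<subseteq> carrier_vec k" using sub by blast
  show ?thesis
  proof (intro equalityI subsetI)
    fix u assume "u \<in> span S"
    then show "u \<in> N"
      using span_is_subset[OF sub(1) vec_submoduleI[OF sub(2) cl]] by blast
  next
    fix u assume "u \<in> N"
    then show "u \<in> span S"
    proof (rule min)
      interpret s: submodule class_ring "span S" V by (rule span_is_submodule) (use S in auto)
      show "S \<subseteq> span S" using in_own_span S by auto
      show "0\<^sub>v k \<in> span S" using s.zero_closed by (simp add: module_vec_simps)
      show "span S \<subseteq> carrier_vec k" using s.subset by (simp add: module_vec_simps)
      show "u + v \<in> span S" if "u \<in> span S" "v \<in> span S" for u v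
        using s.m_closed[OF that] by (simp add: module_vec_simps)
      show "a \<cdot>\<^sub>v u \<in> span S" if "u \<in> span S" for a u
        using s.smult_closed[of a, OF _ that] by (simp add: module_vec_simps)
    qed
  qed
qed

lemma vec_mem_of_coordinates:
  fixes N :: "'k::field vec set"
  assumes N: "0\<^sub>v k \<in> N" "N \<subseteq> carrier_vec k" "\<And>u v. u \<in> N \<Longrightarrow> v \<in> N \<Longrightarrow> u + v \<in> N"
      "\<And>a u. u \<in> N \<Longrightarrow> a \<cdot>\<^sub>v u \<in> N"
    and fin: "finite J" and g: "\<And>j. j \<in> J \<Longrightarrow> g j \<in> N"
  shows "vec k (\<lambda>i. \<Sum>j\<in>J. a j * (g j $ i)) \<in> N"
  using fin g
proof (induction J)
  case empty
  have "vec k (\<lambda>i. \<Sum>j\<in>{}. a j * (g j $ i)) = 0\<^sub>v k" by auto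
  then show ?case using N by simp
next
  case (insert n J)
  have "vec k (\<lambda>i. \<Sum>j\<in>insert n J. a j * (g j $ i)) = a n \<cdot>\<^sub>v g n + vec k (\<lambda>i. \<Sum>j\<in>J. a j * (g j $ i))"
  proof -
    have "g n \<in> carrier_vec k" using insert.prems N(2) by blast
    then show ?thesis using insert.hyps by (intro eq_vecI) auto
  qed
  then show ?case using insert N by simp
qed

lemma span_unit_vecs:
  fixes k :: nat
  shows "LinearCombinations.module.span class_ring (module_vec TYPE('k::field) k) {unit_vec k i | i. i < k \<and> P i}
    = {u \<in> carrier_vec k. \<forall>i<k. u $ i \<noteq> 0 \<longrightarrow> P i}"
proof (rule vec_span_eqI)
  fix u :: "'k vec" and N' :: "'k vec set"
  assume u: "u \<in> {u \<in> carrier_vec k. \<forall>i<k. u $ i \<noteq> 0 \<longrightarrow> P i}" and S: "{unit_vec k i | i. i < k \<and> P i} \<subseteq> N'"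
    and N': "0\<^sub>v k \<in> N'" "N' \<subseteq> carrier_vec k" "\<And>u v. u \<in> N' \<Longrightarrow> v \<in> N' \<Longrightarrow> u + v \<in> N'" "\<And>a u. u \<in> N' \<Longrightarrow> a \<cdot>\<^sub>v u \<in> N'"
  have "vec k (\<lambda>i. \<Sum>j\<in>{j. j < k \<and> P j}. u $ j * (unit_vec k j $ i)) \<in> N'"
    by (rule vec_mem_of_coordinates[OF N']) (use S in auto)
  also have "vec k (\<lambda>i. \<Sum>j\<in>{j. j < k \<and> P j}. u $ j * (unit_vec k j $ i)) = u"
  proof (intro eq_vecI)
    fix i assume "i < dim_vec u"
    then have i: "i < k" using u by auto
    have "(\<Sum>j\<in>{j. j < k \<and> P j}. u $ j * (unit_vec k j $ i)) = (\<Sum>j\<in>{j. j < k \<and> P j}. if j = i then u $ j else 0)"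
      using i by (intro sum.cong) auto
    also have "\<dots> = u $ i" using u i by (auto simp: sum.delta)
    finally show "vec k (\<lambda>i. \<Sum>j\<in>{j. j < k \<and> P j}. u $ j * (unit_vec k j $ i)) $ i = u $ i" using i by simp
  qed (use u in auto)
  finally show "u \<in> N'" .
qed (auto, (metis add_cancel_right_right)?)

lemma span_cols:
  fixes A :: "'k::field mat"
  shows "LinearCombinations.module.span class_ring (module_vec TYPE('k) (dim_row A)) {col A j | j. j < dim_col A \<and> P j}
    = col_combs A {j. j < dim_col A \<and> P j}" (is "_ = col_combs A ?J")
proof (rule vec_span_eqI)
  show "{col A j | j. j < dim_col A \<and> P j} \<subseteq> col_combs A ?J"
  proof clarify
    fix j assume j: "j < dim_col A" "P j"
    have "(\<Sum>j'\<in>?J. (if j' = j then 1 else 0) * A $$ (i, j')) = A $$ (i, j)" for i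
      using j by (subst sum.cong[OF refl, of _ _ "\<lambda>j'. if j' = j then A $$ (i, j') else 0"]) auto
    then show "col A j \<in> col_combs A ?J"
      using j unfolding col_combs_def by (auto intro!: exI[of _ "\<lambda>j'. if j' = j then 1 else 0"])
  qed
  show "0\<^sub>v (dim_row A) \<in> col_combs A ?J" unfolding col_combs_def by (auto intro!: exI[of _ "\<lambda>_. 0"])
  show "u + v \<in> col_combs A ?J" if uv: "u \<in> col_combs A ?J" "v \<in> col_combs A ?J" for u v
  proof -
    obtain a where a: "\<forall>i < dim_row A. u $ i = (\<Sum>j\<in>?J. a j * A $$ (i, j))" using uv by (auto simp: col_combs_def)
    obtain b where b: "\<forall>i < dim_row A. v $ i = (\<Sum>j\<in>?J. b j * A $$ (i, j))" using uv by (auto simp: col_combs_def)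
    show ?thesis using uv a b unfolding col_combs_def
      by (auto intro!: exI[of _ "\<lambda>j. a j + b j"] simp: ring_distribs sum.distrib)
  qed
  show "c \<cdot>\<^sub>v u \<in> col_combs A ?J" if uv: "u \<in> col_combs A ?J" for c u
  proof -
    obtain a where a: "\<forall>i < dim_row A. u $ i = (\<Sum>j\<in>?J. a j * A $$ (i, j))" using uv by (auto simp: col_combs_def)
    show ?thesis using uv a unfolding col_combs_def
      by (auto intro!: exI[of _ "\<lambda>j. c * a j"] simp: sum_distrib_left mult.assoc)
  qed
  fix u :: "'k vec" and N' :: "'k vec set"
  assume u: "u \<in> col_combs A ?J" and S: "{col A j | j. j < dim_col A \<and> P j} \<subseteq> N'"
    and N': "0\<^sub>v (dim_row A) \<in> N'" "N' \<subseteq> carrier_vec (dim_row A)" "\<And>u v. u \<in> N' \<Longrightarrow> v \<in> N' \<Longrightarrow> u + v \<in> N'" "\<And>a u. u \<in> N' \<Longrightarrow> a \<cdot>\<^sub>v u \<in> N'"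
  obtain a where a: "\<forall>i < dim_row A. u $ i = (\<Sum>j\<in>?J. a j * A $$ (i, j))" using u by (auto simp: col_combs_def)
  have "vec (dim_row A) (\<lambda>i. \<Sum>j\<in>?J. a j * (col A j $ i)) \<in> N'"
    by (rule vec_mem_of_coordinates[OF N']) (use S in auto)
  also have "vec (dim_row A) (\<lambda>i. \<Sum>j\<in>?J. a j * (col A j $ i)) = u"
    using u a by (intro eq_vecI) (auto simp: col_combs_def intro!: sum.cong)
  finally show "u \<in> N'" .
qed (auto simp: col_combs_def)

definition coordinates :: "nat \<Rightarrow> ('k::field vec \<Rightarrow> nat \<Rightarrow> 'k) \<Rightarrow> bool" where
  "coordinates k \<Phi> \<longleftrightarrow>
     (\<forall>u\<in>carrier_vec k. \<forall>v\<in>carrier_vec k. \<forall>i<k. \<Phi> (u + v) i = \<Phi> u i + \<Phi> v i) \<and>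
     (\<forall>a. \<forall>u\<in>carrier_vec k. \<forall>i<k. \<Phi> (a \<cdot>\<^sub>v u) i = a * \<Phi> u i) \<and>
     (\<forall>f. \<exists>u\<in>carrier_vec k. \<forall>i<k. \<Phi> u i = f i)"

lemma coordinates_diff:
  assumes "coordinates k \<Phi>" "u \<in> carrier_vec k" "v \<in> carrier_vec k" "i < k"
  shows "\<Phi> (u - v) i = \<Phi> u i - \<Phi> v i"
proof -
  have eq: "u - v = u + (-1) \<cdot>\<^sub>v v" using assms(2,3) by (intro eq_vecI) auto
  have "\<Phi> (u + (-1) \<cdot>\<^sub>v v) i = \<Phi> u i + \<Phi> ((-1) \<cdot>\<^sub>v v) i"
    using assms unfolding coordinates_def by (simp del: smult_vec_def)
  also have "\<Phi> ((-1) \<cdot>\<^sub>v v) i = (-1) * \<Phi> v i"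
    using assms unfolding coordinates_def by blast
  finally show ?thesis unfolding eq by simp
qed

text \<open>Two filtrations of a finite-dimensional space, here the coordinate subspaces and the column
  spaces, have a common adapted basis. The lemma is stated through the coordinates \<open>\<Phi>\<close> in that basis.
  This is the standard column reduction: columns are added in the order of their grades, and a new
  column, expanded in the current basis and stripped of the directions \<open>T\<close> that are already
  killed, replaces the basis vector \<open>m\<close> of highest row grade in its support. Choosing the highest grade
  keeps the row filtration adapted, and \<open>m \<notin> T\<close> leaves the earlier column spaces untouched.\<close>

lemma adapted_coordinates:
  fixes A :: "'k::field mat" and r c :: "nat \<Rightarrow> 'a::linorder"
  assumes "finite J" "J \<subseteq> {..<dim_col A}"
  shows "\<exists>\<Phi> T d. coordinates (dim_row A) \<Phi> \<and> T \<subseteq> {..<dim_row A} \<and> d ` T \<subseteq> J \<and>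
    (\<forall>x. \<forall>u\<in>carrier_vec (dim_row A).
       (\<forall>i<dim_row A. u $ i \<noteq> 0 \<longrightarrow> r i \<le> x) \<longleftrightarrow> (\<forall>i<dim_row A. \<Phi> u i \<noteq> 0 \<longrightarrow> r i \<le> x)) \<and>
    (\<forall>x. \<forall>u\<in>carrier_vec (dim_row A). u \<in> col_combs A {j \<in> J. c j \<le> x} \<longleftrightarrow>
       (\<forall>i<dim_row A. \<Phi> u i \<noteq> 0 \<longrightarrow> i \<in> T \<and> c (d i) \<le> x))"
  using assms
proof (induction J rule: finite_ranking_induct[where f = c])
  case empty
  define \<Phi> :: "'k vec \<Rightarrow> nat \<Rightarrow> 'k" where "\<Phi> = ($)"
  have 1: "coordinates (dim_row A) \<Phi>" unfolding coordinates_def \<Phi>_def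
    by (auto intro: bexI[of _ "vec (dim_row A) _"])
  have 2: "u \<in> col_combs A {} \<longleftrightarrow> (\<forall>i<dim_row A. \<Phi> u i = 0)" if "u \<in> carrier_vec (dim_row A)" for u
    using that by (auto simp: col_combs_empty \<Phi>_def)
  show ?case
    by (intro exI[of _ \<Phi>] exI[of _ "{}"] exI conjI) (use 1 2 in \<open>auto simp: \<Phi>_def\<close>)
next
  case (insert n J)
  let ?k = "dim_row A"
  obtain \<Phi> T d where co: "coordinates ?k \<Phi>" and T: "T \<subseteq> {..<?k}" "d ` T \<subseteq> J"
    and gens: "\<And>x u. u\<in>carrier_vec ?k \<Longrightarrow>
       (\<forall>i<?k. u $ i \<noteq> 0 \<longrightarrow> r i \<le> x) \<longleftrightarrow> (\<forall>i<?k. \<Phi> u i \<noteq> 0 \<longrightarrow> r i \<le> x)"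
    and rels: "\<And>x u. u\<in>carrier_vec ?k \<Longrightarrow> u \<in> col_combs A {j \<in> J. c j \<le> x} \<longleftrightarrow>
       (\<forall>i<?k. \<Phi> u i \<noteq> 0 \<longrightarrow> i \<in> T \<and> c (d i) \<le> x)"
    using insert.IH insert.prems by auto
  show ?case
  proof (cases "n \<in> J")
    case True
    then show ?thesis using insert.IH insert.prems by (simp add: insert_absorb)
  next
    case nJ: False
    have n: "n < dim_col A" using insert.prems by simp
    define \<alpha> where "\<alpha> = \<Phi> (col A n)"
    have colA: "col A n \<in> carrier_vec ?k" by simp
    have low: "{j \<in> insert n J. c j \<le> x} = {j \<in> J. c j \<le> x}" if "\<not> c n \<le> x" for x using that by auto
    have high: "{j \<in> insert n J. c j \<le> x} = insert n J" "{j \<in> J. c j \<le> x} = J" if "c n \<le> x" for x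
      using that insert.hyps(2) by (auto intro: order_trans)
    have cd: "c (d i) \<le> x" if "i \<in> T" "c n \<le> x" for i x
      using that T(2) insert.hyps(2) by (meson image_subset_iff order_trans)
    have relsJ: "u \<in> col_combs A J \<longleftrightarrow> (\<forall>i<?k. \<Phi> u i \<noteq> 0 \<longrightarrow> i \<in> T)" if "u \<in> carrier_vec ?k" for u
      using rels[OF that, of "c n"] high[of "c n"] cd[of _ "c n"] by auto
    have insJ: "u \<in> col_combs A (insert n J) \<longleftrightarrow> (\<exists>b. \<forall>i<?k. i \<notin> T \<longrightarrow> \<Phi> u i = b * \<alpha> i)"
      if u: "u \<in> carrier_vec ?k" for u
    proof -
      have eq: "\<Phi> (u - b \<cdot>\<^sub>v col A n) i = \<Phi> u i - b * \<alpha> i" if "i < ?k" for b i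
        using coordinates_diff[OF co u _ that, of "b \<cdot>\<^sub>v col A n"] co that colA
        unfolding coordinates_def \<alpha>_def by auto
      have "u - b \<cdot>\<^sub>v col A n \<in> col_combs A J \<longleftrightarrow> (\<forall>i<?k. i \<notin> T \<longrightarrow> \<Phi> u i = b * \<alpha> i)" for b
        using eq relsJ[of "u - b \<cdot>\<^sub>v col A n"] u by auto
      then show ?thesis using col_combs_insert[OF insert.hyps(1) nJ n] u by simp
    qed
    show ?thesis
    proof (cases "\<forall>i<?k. i \<notin> T \<longrightarrow> \<alpha> i = 0")
      case True
      have "u \<in> col_combs A {j \<in> insert n J. c j \<le> x} \<longleftrightarrow>
       (\<forall>i<?k. \<Phi> u i \<noteq> 0 \<longrightarrow> i \<in> T \<and> c (d i) \<le> x)" if u: "u\<in>carrier_vec ?k" for u x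
        using rels[OF u, of x] low[of x] high[of x] insJ[OF u] relsJ[OF u] True by (cases "c n \<le> x") auto
      then show ?thesis using co T gens by (intro exI[of _ \<Phi>] exI[of _ T] exI[of _ d]) auto
    next
      case False
      define B where "B = {i. i < ?k \<and> i \<notin> T \<and> \<alpha> i \<noteq> 0}"
      have B: "finite B" "B \<noteq> {}" using False by (auto simp: B_def)
      obtain m where m: "m \<in> B" "\<And>i. i \<in> B \<Longrightarrow> r i \<le> r m"
      proof -
        have "Max (r ` B) \<in> r ` B" using B by (intro Max_in) auto
        then obtain m where "m \<in> B" "r m = Max (r ` B)" by force
        then show ?thesis using that[of m] B(1) by simp
      qed
      have m': "m < ?k" "m \<notin> T" "\<alpha> m \<noteq> 0" using m(1) by (auto simp: B_def)
      \<comment> \<open>Coordinates after the \<open>m\<close>-th basis vector has been replaced by the part of the column that is supported outside \<open>T\<close>.\<close>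
      define \<Psi> where "\<Psi> u i = (if i = m then \<Phi> u m / \<alpha> m else if i \<in> T then \<Phi> u i
        else \<Phi> u i - \<Phi> u m / \<alpha> m * \<alpha> i)" for u i
      have same: "\<Psi> u i = \<Phi> u i" if "\<Phi> u m = 0" for u i using that by (simp add: \<Psi>_def)
      have zero_m: "\<Psi> u m = 0 \<longleftrightarrow> \<Phi> u m = 0" for u using m' by (simp add: \<Psi>_def)
      have off_B: "\<Psi> u i = \<Phi> u i" if "i < ?k" "i \<notin> B" for u i using that m(1) by (auto simp: \<Psi>_def B_def)
      have co': "coordinates ?k \<Psi>"
        unfolding coordinates_def
      proof (intro conjI allI ballI impI)
        show "\<Psi> (u + v) i = \<Psi> u i + \<Psi> v i" if "u \<in> carrier_vec ?k" "v \<in> carrier_vec ?k" "i < ?k" for u v i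
          using co that m' unfolding coordinates_def \<Psi>_def by (simp add: field_simps)
        show "\<Psi> (a \<cdot>\<^sub>v u) i = a * \<Psi> u i" if "u \<in> carrier_vec ?k" "i < ?k" for a u i
          using co that m' unfolding coordinates_def \<Psi>_def by (simp add: field_simps)
        fix f :: "nat \<Rightarrow> 'k"
        define h where "h i = (if i = m then f m * \<alpha> m else if i \<in> T then f i else f i + f m * \<alpha> i)" for i
        have "\<exists>u\<in>carrier_vec ?k. \<forall>i<?k. \<Phi> u i = h i"
          using co unfolding coordinates_def by blast
        then obtain u where u: "u \<in> carrier_vec ?k" "\<And>i. i < ?k \<Longrightarrow> \<Phi> u i = h i" by blast
        then have "\<forall>i<?k. \<Psi> u i = f i" using m' by (simp add: \<Psi>_def h_def)
        then show "\<exists>u\<in>carrier_vec ?k. \<forall>i<?k. \<Psi> u i = f i" using u(1) by blast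
      qed
      have gens': "(\<forall>i<?k. u $ i \<noteq> 0 \<longrightarrow> r i \<le> x) \<longleftrightarrow> (\<forall>i<?k. \<Psi> u i \<noteq> 0 \<longrightarrow> r i \<le> x)"
        if u: "u \<in> carrier_vec ?k" for u x
      proof (cases "r m \<le> x")
        case True
        then have "r i \<le> x" if "i \<in> B" for i using m(2)[OF that] by simp
        then show ?thesis using gens[OF u, of x] off_B by metis
      next
        case False
        then show ?thesis using gens[OF u, of x] zero_m same m'(1) by metis
      qed
      have rels': "u \<in> col_combs A {j \<in> insert n J. c j \<le> x} \<longleftrightarrow>
         (\<forall>i<?k. \<Psi> u i \<noteq> 0 \<longrightarrow> i \<in> insert m T \<and> c ((d(m := n)) i) \<le> x)" if u: "u\<in>carrier_vec ?k" for u x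
      proof (cases "c n \<le> x")
        case False
        have "(\<forall>i<?k. \<Psi> u i \<noteq> 0 \<longrightarrow> i \<in> insert m T \<and> c ((d(m := n)) i) \<le> x) \<longleftrightarrow>
            (\<forall>i<?k. \<Phi> u i \<noteq> 0 \<longrightarrow> i \<in> T \<and> c (d i) \<le> x)"
        proof (cases "\<Phi> u m = 0")
          case True
          then show ?thesis using same[OF True] m' by (metis fun_upd_apply insertE insertI2)
        next
          case nz: False
          then show ?thesis using zero_m m' False by auto
        qed
        then show ?thesis using rels[OF u, of x] low[OF False] by simp
      next
        case True
        have "(\<exists>b. \<forall>i<?k. i \<notin> T \<longrightarrow> \<Phi> u i = b * \<alpha> i) \<longleftrightarrow> (\<forall>i<?k. \<Psi> u i \<noteq> 0 \<longrightarrow> i \<in> insert m T)"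
        proof
          assume "\<exists>b. \<forall>i<?k. i \<notin> T \<longrightarrow> \<Phi> u i = b * \<alpha> i"
          then show "\<forall>i<?k. \<Psi> u i \<noteq> 0 \<longrightarrow> i \<in> insert m T" using m' by (auto simp: \<Psi>_def)
        next
          assume R: "\<forall>i<?k. \<Psi> u i \<noteq> 0 \<longrightarrow> i \<in> insert m T"
          have "\<Phi> u i = \<Phi> u m / \<alpha> m * \<alpha> i" if "i < ?k" "i \<notin> T" for i
            using R that m' by (cases "i = m") (auto simp: \<Psi>_def)
          then show "\<exists>b. \<forall>i<?k. i \<notin> T \<longrightarrow> \<Phi> u i = b * \<alpha> i" by blast
        qed
        then show ?thesis using insJ[OF u] high(1)[OF True] cd True by auto
      qed
      show ?thesis
        by (intro exI[of _ \<Psi>] exI[of _ "insert m T"] exI[of _ "d(m := n)"])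
          (use co' gens' rels' T m' in auto)
    qed
  qed
qed

section \<open>Barcodes of presented modules\<close>

text \<open>The vectors of the basis that underlies \<open>\<Phi>\<close> are born at their row grades, and those in \<open>T\<close> die at
  the grade of the column that \<open>d\<close> pairs with them.\<close>

definition splits ::
  "('p::order, 'k::field) presentation \<Rightarrow> ('k vec \<Rightarrow> nat \<Rightarrow> 'k) \<Rightarrow> nat set \<Rightarrow> (nat \<Rightarrow> nat) \<Rightarrow> bool" where
  "splits P \<Phi> T d \<longleftrightarrow> coordinates (dim_row (pmat P)) \<Phi> \<and> T \<subseteq> {..<dim_row (pmat P)} \<and> d ` T \<subseteq> {..<dim_col (pmat P)} \<and>
    (\<forall>x. pres_gens P x = {u \<in> carrier_vec (dim_row (pmat P)). \<forall>i<dim_row (pmat P). \<Phi> u i \<noteq> 0 \<longrightarrow> row_gr P i \<le> x}) \<and>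
    (\<forall>x. pres_rels P x = {u \<in> carrier_vec (dim_row (pmat P)).
       \<forall>i<dim_row (pmat P). \<Phi> u i \<noteq> 0 \<longrightarrow> i \<in> T \<and> col_gr P (d i) \<le> x})"

lemma pres_gens_eq:
  "pres_gens P x = {u \<in> carrier_vec (dim_row (pmat P)). \<forall>i<dim_row (pmat P). u $ i \<noteq> 0 \<longrightarrow> row_gr P i \<le> x}"
  unfolding pres_gens_def by (rule span_unit_vecs)

lemma pres_rels_eq: "pres_rels P x = col_combs (pmat P) {j. j < dim_col (pmat P) \<and> col_gr P j \<le> x}"
  unfolding pres_rels_def by (rule span_cols)

lemma splits_exists:
  fixes P :: "('p::linorder, 'k::field) presentation"
  shows "\<exists>\<Phi> T d. splits P \<Phi> T d"
proof -
  let ?k = "dim_row (pmat P)"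
  obtain \<Phi> T d where *: "coordinates ?k \<Phi>" "T \<subseteq> {..<?k}" "d ` T \<subseteq> {..<dim_col (pmat P)}"
    "\<And>x u. u\<in>carrier_vec ?k \<Longrightarrow>
       (\<forall>i<?k. u $ i \<noteq> 0 \<longrightarrow> row_gr P i \<le> x) \<longleftrightarrow> (\<forall>i<?k. \<Phi> u i \<noteq> 0 \<longrightarrow> row_gr P i \<le> x)"
    "\<And>x u. u\<in>carrier_vec ?k \<Longrightarrow> u \<in> col_combs (pmat P) {j \<in> {..<dim_col (pmat P)}. col_gr P j \<le> x} \<longleftrightarrow>
       (\<forall>i<?k. \<Phi> u i \<noteq> 0 \<longrightarrow> i \<in> T \<and> col_gr P (d i) \<le> x)"
    using adapted_coordinates[of "{..<dim_col (pmat P)}" "pmat P" "row_gr P" "col_gr P"] by auto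
  have "pres_gens P x = {u \<in> carrier_vec ?k. \<forall>i<?k. \<Phi> u i \<noteq> 0 \<longrightarrow> row_gr P i \<le> x}" for x
    unfolding pres_gens_eq using *(4) by blast
  moreover have "pres_rels P x = {u \<in> carrier_vec ?k. \<forall>i<?k. \<Phi> u i \<noteq> 0 \<longrightarrow> i \<in> T \<and> col_gr P (d i) \<le> x}" for x
    unfolding pres_rels_eq using *(5)[of _ x] by (auto simp: col_combs_def)
  ultimately show ?thesis unfolding splits_def using *(1-3) by blast
qed

lemma threshold_transfer:
  fixes g g' :: "'i \<Rightarrow> 'a::{linorder, no_bot}"
  assumes fin: "finite I" and ord: "\<And>i j. i \<in> I \<Longrightarrow> j \<in> I \<Longrightarrow> g i \<le> g j \<longleftrightarrow> g' i \<le> g' j"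
  shows "\<exists>x. \<forall>i\<in>I. g' i \<le> x' \<longleftrightarrow> g i \<le> x"
proof (cases "\<exists>i\<in>I. g' i \<le> x'")
  case True
  let ?X = "g ` {i \<in> I. g' i \<le> x'}"
  have "Max ?X \<in> ?X" using True fin by (intro Max_in) auto
  then obtain j where j: "j \<in> I" "g' j \<le> x'" "Max ?X = g j" by auto
  have "g' i \<le> x' \<longleftrightarrow> g i \<le> g j" if "i \<in> I" for i
  proof
    assume "g' i \<le> x'"
    then show "g i \<le> g j" unfolding j(3)[symmetric] using that fin by (intro Max_ge) auto
  next
    assume "g i \<le> g j"
    then show "g' i \<le> x'" using ord[OF that j(1)] j(2) by simp
  qed
  then show ?thesis by blast
next
  case False
  obtain x where x: "\<And>i. i \<in> I \<Longrightarrow> x < g i"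
  proof (cases "I = {}")
    case False
    obtain x where "x < Min (g ` I)" using lt_ex by blast
    then show ?thesis using that[of x] fin False by simp
  qed (use that in blast)
  then show ?thesis using False by (intro exI[of _ x]) (auto simp: not_le dest: leD)
qed

definition regrade :: "('q \<Rightarrow> 'p) \<Rightarrow> ('q, 'k) presentation \<Rightarrow> ('p, 'k) presentation" where
  "regrade g P = \<lparr>pmat = pmat P, row_gr = g \<circ> row_gr P, col_gr = g \<circ> col_gr P\<rparr>"

definition same_order :: "'q set \<Rightarrow> ('q \<Rightarrow> real) \<Rightarrow> ('q \<Rightarrow> real) \<Rightarrow> bool" where
  "same_order G g g' \<longleftrightarrow> (\<forall>p\<in>G. \<forall>q\<in>G. g p \<le> g q \<longleftrightarrow> g' p \<le> g' q)"

definition grades :: "('q, 'k) presentation \<Rightarrow> 'q set" where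
  "grades P = row_gr P ` {..<dim_row (pmat P)} \<union> col_gr P ` {..<dim_col (pmat P)}"

text \<open>A presentation enters through its sublevel sets of grades only, and order-equivalent grade
  functions have the same sublevel sets. Hence one change of coordinates serves a whole cell of
  slices.\<close>

lemma splits_transfer:
  fixes P :: "('q::order, 'k::field) presentation"
  assumes ord: "same_order (grades P) g g'" and sp: "splits (regrade g P) \<Phi> T d"
  shows "splits (regrade g' P) \<Phi> T d"
proof -
  let ?k = "dim_row (pmat P)"
  let ?P = "regrade g P" and ?P' = "regrade g' P"
  have T: "T \<subseteq> {..<?k}" "d ` T \<subseteq> {..<dim_col (pmat P)}" using sp by (auto simp: splits_def regrade_def)
  have *: "pres_gens ?P' x' = {u \<in> carrier_vec ?k. \<forall>i<?k. \<Phi> u i \<noteq> 0 \<longrightarrow> g' (row_gr P i) \<le> x'} \<and>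
        pres_rels ?P' x' = {u \<in> carrier_vec ?k. \<forall>i<?k. \<Phi> u i \<noteq> 0 \<longrightarrow> i \<in> T \<and> g' (col_gr P (d i)) \<le> x'}" for x'
  proof -
    have "finite (grades P)" by (simp add: grades_def)
    then obtain x where x: "\<And>p. p \<in> grades P \<Longrightarrow> g' p \<le> x' \<longleftrightarrow> g p \<le> x"
      using threshold_transfer[of "grades P" g g' x'] ord unfolding same_order_def by blast
    have r: "g' (row_gr P i) \<le> x' \<longleftrightarrow> g (row_gr P i) \<le> x" if "i < ?k" for i
      by (rule x) (use that in \<open>auto simp: grades_def\<close>)
    have c: "g' (col_gr P j) \<le> x' \<longleftrightarrow> g (col_gr P j) \<le> x" if "j < dim_col (pmat P)" for j
      by (rule x) (use that in \<open>auto simp: grades_def\<close>)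
    have 1: "pres_gens ?P' x' = pres_gens ?P x"
      unfolding pres_gens_eq regrade_def using r by auto
    have 2: "pres_rels ?P' x' = pres_rels ?P x"
      unfolding pres_rels_eq regrade_def using c by (auto intro!: arg_cong[of _ _ "col_combs (pmat P)"])
    have 3: "pres_gens ?P x = {u \<in> carrier_vec ?k. \<forall>i<?k. \<Phi> u i \<noteq> 0 \<longrightarrow> g (row_gr P i) \<le> x}"
      "pres_rels ?P x = {u \<in> carrier_vec ?k. \<forall>i<?k. \<Phi> u i \<noteq> 0 \<longrightarrow> i \<in> T \<and> g (col_gr P (d i)) \<le> x}"
      using sp unfolding splits_def by (simp_all add: regrade_def)
    have "i \<in> T \<and> g (col_gr P (d i)) \<le> x \<longleftrightarrow> i \<in> T \<and> g' (col_gr P (d i)) \<le> x'" for i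
      using T(2) c[of "d i"] by auto
    then show ?thesis unfolding 1 2 3 using r by auto
  qed
  then show ?thesis using sp by (simp add: splits_def regrade_def)
qed

lemma interval_sum_simps:
  fixes b :: "'i \<Rightarrow> real" and e :: "'i \<Rightarrow> ereal" and I :: "'i set"
  defines "N \<equiv> pmod_sum I (\<lambda>i. interval_module (b i) (e i) :: (real, 'k::field, 'k) pmod)"
  shows "carrier (space N x) = {f \<in> extensional I. \<forall>i\<in>I. \<not> (b i \<le> x \<and> ereal x < e i) \<longrightarrow> f i = 0}"
    and "zero (space N x) = (\<lambda>i\<in>I. 0)"
    and "f \<oplus>\<^bsub>space N x\<^esub> g = (\<lambda>i\<in>I. f i + g i)"
    and "a \<odot>\<^bsub>space N x\<^esub> f = (\<lambda>i\<in>I. a * f i)"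
    and "pmap N x y f = (\<lambda>i\<in>I. if b i \<le> x \<and> ereal y < e i then f i else 0)"
proof -
  have "f i \<in> (if b i \<le> x \<and> ereal x < e i then UNIV else {0}) \<longleftrightarrow> (\<not> (b i \<le> x \<and> ereal x < e i) \<longrightarrow> f i = 0)"
    for f :: "'i \<Rightarrow> 'k" and i by simp
  then show "carrier (space N x) = {f \<in> extensional I. \<forall>i\<in>I. \<not> (b i \<le> x \<and> ereal x < e i) \<longrightarrow> f i = 0}"
    by (auto simp: N_def pmod_sum_def interval_module_def PiE_def Pi_def extensional_def simp del: Set.if_split_mem2)
qed (simp_all add: N_def pmod_sum_def interval_module_def)

lemma vectorspace_interval_sum:
  "vectorspace class_ring (space (pmod_sum I (\<lambda>i. interval_module (b i) (e i) :: (real, 'k::field, 'k) pmod)) x)"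
proof -
  let ?V = "space (pmod_sum I (\<lambda>i. interval_module (b i) (e i) :: (real, 'k, 'k) pmod)) x"
  note V = interval_sum_simps
  have ext: "f = g" if "f \<in> extensional I" "g \<in> extensional I" "\<And>i. i \<in> I \<Longrightarrow> f i = g i" for f g :: "'a \<Rightarrow> 'k"
    using that by (rule extensionalityI)
  have "Module.module class_ring ?V"
  proof (rule module_criteria, goal_cases)
    case 4
    show ?case
    proof
      fix f assume "f \<in> carrier ?V"
      then show "\<exists>g\<in>carrier ?V. f \<oplus>\<^bsub>?V\<^esub> g = \<zero>\<^bsub>?V\<^esub>"
        unfolding V by (intro bexI[of _ "\<lambda>i\<in>I. - f i"]) auto
    qed
  qed (auto simp: V class_cring.is_cring algebra_simps intro!: ext)
  then show ?thesis unfolding vectorspace_def using class_field by blast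
qed

text \<open>Basis vectors that die as soon as they are born contribute no bar, since a diagram only has pairs
  \<open>(b, d)\<close> with \<open>b < d\<close>.\<close>

definition bars :: "nat \<Rightarrow> nat set \<Rightarrow> (nat \<Rightarrow> real) \<Rightarrow> (nat \<Rightarrow> real) \<Rightarrow> (real \<times> ereal) multiset" where
  "bars k T r c = image_mset (\<lambda>i. (r i, if i \<in> T then ereal (c i) else \<infinity>))
     (mset_set {i. i < k \<and> (i \<in> T \<longrightarrow> r i < c i)})"

lemma linear_mapI:
  assumes "vectorspace K V" "vectorspace K W" "f \<in> carrier V \<rightarrow> carrier W"
    "\<And>u v. u \<in> carrier V \<Longrightarrow> v \<in> carrier V \<Longrightarrow> f (u \<oplus>\<^bsub>V\<^esub> v) = f u \<oplus>\<^bsub>W\<^esub> f v"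
    "\<And>a u. a \<in> carrier K \<Longrightarrow> u \<in> carrier V \<Longrightarrow> f (a \<odot>\<^bsub>V\<^esub> u) = a \<odot>\<^bsub>W\<^esub> f u"
  shows "linear_map K V W f"
  using assms by (auto simp: linear_map_def mod_hom_def mod_hom_axioms_def LinearCombinations.module_hom_def vectorspace_def)

lemma linear_mapD:
  assumes "linear_map K V W f"
  shows "vectorspace K V" "vectorspace K W" "f \<in> carrier V \<rightarrow> carrier W"
    "\<And>u v. u \<in> carrier V \<Longrightarrow> v \<in> carrier V \<Longrightarrow> f (u \<oplus>\<^bsub>V\<^esub> v) = f u \<oplus>\<^bsub>W\<^esub> f v"
    "\<And>a u. a \<in> carrier K \<Longrightarrow> u \<in> carrier V \<Longrightarrow> f (a \<odot>\<^bsub>V\<^esub> u) = a \<odot>\<^bsub>W\<^esub> f u"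
  using assms by (auto simp: linear_map_def mod_hom_def mod_hom_axioms_def LinearCombinations.module_hom_def)

lemma pmod_iso_trans:
  assumes "M \<cong>\<^sub>p N" "N \<cong>\<^sub>p L"
  shows "M \<cong>\<^sub>p L"
proof -
  obtain \<phi> where \<phi>: "\<And>p. linear_map class_ring (space M p) (space N p) (\<phi> p)"
      "\<And>p. bij_betw (\<phi> p) (carrier (space M p)) (carrier (space N p))"
      "\<And>p q v. p \<le> q \<Longrightarrow> v \<in> carrier (space M p) \<Longrightarrow> \<phi> q (pmap M p q v) = pmap N p q (\<phi> p v)"
    using assms(1) unfolding pmod_iso_def by blast
  obtain \<psi> where \<psi>: "\<And>p. linear_map class_ring (space N p) (space L p) (\<psi> p)"
      "\<And>p. bij_betw (\<psi> p) (carrier (space N p)) (carrier (space L p))"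
      "\<And>p q v. p \<le> q \<Longrightarrow> v \<in> carrier (space N p) \<Longrightarrow> \<psi> q (pmap N p q v) = pmap L p q (\<psi> p v)"
    using assms(2) unfolding pmod_iso_def by blast
  have mem: "\<phi> p v \<in> carrier (space N p)" if "v \<in> carrier (space M p)" for p v
    using linear_mapD(3)[OF \<phi>(1)[of p]] that by blast
  have "linear_map class_ring (space M p) (space L p) (\<psi> p \<circ> \<phi> p)" for p
    using linear_mapD[OF \<phi>(1)[of p]] linear_mapD[OF \<psi>(1)[of p]] mem[of _ p]
    by (intro linear_mapI) auto
  moreover have "bij_betw (\<psi> p \<circ> \<phi> p) (carrier (space M p)) (carrier (space L p))" for p
    by (rule bij_betw_trans[OF \<phi>(2) \<psi>(2)])
  moreover have "(\<psi> q \<circ> \<phi> q) (pmap M p q v) = pmap L p q ((\<psi> p \<circ> \<phi> p) v)"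
    if "p \<le> q" "v \<in> carrier (space M p)" for p q v
    using that \<phi>(3) \<psi>(3) mem by simp
  ultimately show ?thesis unfolding pmod_iso_def by (intro exI[of _ "\<lambda>p. \<psi> p \<circ> \<phi> p"]) blast
qed

lemma is_diagram_iso: "M \<cong>\<^sub>p N \<Longrightarrow> is_diagram N D \<Longrightarrow> is_diagram M D"
  unfolding is_diagram_def using pmod_iso_trans by blast

text \<open>In adapted coordinates both the generators and the relations at \<open>x\<close> are coordinate subspaces, so the
  quotient has the coordinates \<open>i\<close> that are born and not yet dead (\<open>act x i\<close>), and \<open>\<phi>\<close> reads these off
  any member of a coset. That the quotients are vector spaces is an assumption because it comes
  for free with an isomorphism from a persistence module.\<close>

lemma is_diagram_of_splits:
  fixes P :: "(real, 'k::field) presentation"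
  assumes sp: "splits P \<Phi> T d" and vs: "\<And>x. vectorspace class_ring (space (presented_module P) x)"
  shows "is_diagram (presented_module P) (bars (dim_row (pmat P)) T (row_gr P) (\<lambda>i. col_gr P (d i)))"
proof -
  define k where "k = dim_row (pmat P)"
  define death where "death i = (if i \<in> T then ereal (col_gr P (d i)) else \<infinity>)" for i
  define act where "act x i \<longleftrightarrow> row_gr P i \<le> x \<and> ereal x < death i" for x i
  define ks where "ks = filter (\<lambda>i. ereal (row_gr P i) < death i) [0..<k]"
  define xs where "xs = map (\<lambda>i. (row_gr P i, death i)) ks"
  define N :: "(real, 'k, nat \<Rightarrow> 'k) pmod" where
    "N = pmod_sum {..<length xs} (\<lambda>n. interval_module (fst (xs ! n)) (snd (xs ! n)))"
  have co: "coordinates k \<Phi>"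
    and gens: "\<And>x. pres_gens P x = {u \<in> carrier_vec k. \<forall>i<k. \<Phi> u i \<noteq> 0 \<longrightarrow> row_gr P i \<le> x}"
    and rels: "\<And>x. pres_rels P x = {u \<in> carrier_vec k. \<forall>i<k. \<Phi> u i \<noteq> 0 \<longrightarrow> i \<in> T \<and> col_gr P (d i) \<le> x}"
    using sp by (auto simp: splits_def k_def)
  have len: "length xs = length ks" by (simp add: xs_def)
  have ks_lt: "ks ! n < k" if "n < length ks" for n
    using nth_mem[OF that] by (auto simp: ks_def)
  have act_ks: "\<exists>n<length ks. ks ! n = i" if "act x i" "i < k" for x i
  proof -
    have "ereal (row_gr P i) < death i" using that(1) unfolding act_def by (meson ereal_less_eq(3) order_le_less_trans)
    then have "i \<in> set ks" using that(2) by (simp add: ks_def)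
    then show ?thesis by (meson in_set_conv_nth)
  qed
  have rel_act: "\<Phi> w i = 0" if "w \<in> pres_rels P x" "act x i" "i < k" for w x i
    using that by (auto simp: rels act_def death_def split: if_splits)
  have add: "\<Phi> (u + v) i = \<Phi> u i + \<Phi> v i" if "u \<in> carrier_vec k" "v \<in> carrier_vec k" "i < k" for u v i
    using co that by (simp add: coordinates_def)
  have scale: "\<Phi> (a \<cdot>\<^sub>v u) i = a * \<Phi> u i" if "u \<in> carrier_vec k" "i < k" for a u i
    using co that by (simp add: coordinates_def)
  have zero_rel: "0\<^sub>v k \<in> pres_rels P x" for x
  proof -
    have "\<Phi> (0 \<cdot>\<^sub>v 0\<^sub>v k) i = 0 * \<Phi> (0\<^sub>v k) i" if "i < k" for i
      using that by (intro scale) auto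
    moreover have "0 \<cdot>\<^sub>v 0\<^sub>v k = (0\<^sub>v k :: 'k vec)" by (intro eq_vecI) auto
    ultimately show ?thesis by (auto simp: rels)
  qed
  have rel_carr: "w \<in> carrier_vec k" if "w \<in> pres_rels P x" for w x using that by (simp add: rels)
  have gen_carr: "w \<in> carrier_vec k" if "w \<in> pres_gens P x" for w x using that by (simp add: gens)
  define coset where "coset x u = (\<Union>w\<in>pres_rels P x. {w + u})" for x u
  have self: "u \<in> coset x u" if "u \<in> carrier_vec k" for x u
    using zero_rel[of x] that by (auto simp: coset_def intro!: bexI[of _ "0\<^sub>v k"])
  have M_carrier: "carrier (space (presented_module P) x) = coset x ` pres_gens P x" for x
    by (auto simp: presented_module_def quotient_module_def A_RCOSETS_def' a_r_coset_def' module_vec_simps coset_def)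
  have M_add: "X \<oplus>\<^bsub>space (presented_module P) x\<^esub> Y = (\<Union>u\<in>X. \<Union>v\<in>Y. {u + v})" for x X Y
    by (simp add: presented_module_def quotient_module_def set_add_def' module_vec_simps)
  have M_smult: "a \<odot>\<^bsub>space (presented_module P) x\<^esub> X = (\<Union>v\<in>X. coset x (a \<cdot>\<^sub>v v))" for x a X
    by (simp add: presented_module_def quotient_module_def a_r_coset_def' module_vec_simps coset_def)
  have M_pmap: "pmap (presented_module P) x y X = (\<Union>v\<in>X. coset y v)" for x y X
    by (simp add: presented_module_def a_r_coset_def' module_vec_simps coset_def)
  \<comment> \<open>Cosets are handled through the vectors whose live coordinates all their members share.\<close>
  define rep where "rep x X u \<longleftrightarrow> X \<noteq> {} \<and> u \<in> carrier_vec k \<and>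
    (\<forall>w\<in>X. w \<in> carrier_vec k \<and> (\<forall>i<k. act x i \<longrightarrow> \<Phi> w i = \<Phi> u i))" for x X u
  have rep_coset: "rep x (coset x u) u" if "u \<in> carrier_vec k" for x u
    using that zero_rel[of x] rel_act rel_carr by (auto simp: rep_def coset_def add)
  have rep_add: "rep x (\<Union>u\<in>X. \<Union>v\<in>Y. {u + v}) (u + v)" if "rep x X u" "rep x Y v" for x X Y u v
    using that by (auto simp: rep_def add)
  have rep_UN: "rep x (\<Union>v\<in>X. coset x (f v)) w"
    if "X \<noteq> {}" "w \<in> carrier_vec k" "\<And>v. v \<in> X \<Longrightarrow> f v \<in> carrier_vec k"
      "\<And>v i. v \<in> X \<Longrightarrow> i < k \<Longrightarrow> act x i \<Longrightarrow> \<Phi> (f v) i = \<Phi> w i" for x w and X :: "'k vec set" and f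
  proof -
    have "rep x (coset x (f v)) (f v)" if "v \<in> X" for v using rep_coset that \<open>\<And>v. v \<in> X \<Longrightarrow> f v \<in> carrier_vec k\<close> by blast
    then show ?thesis using that unfolding rep_def by auto
  qed
  define \<phi> where "\<phi> x X = (\<lambda>n\<in>{..<length xs}. if act x (ks ! n) then \<Phi> (SOME u. u \<in> X) (ks ! n) else 0)" for x X
  have \<phi>_eq: "\<phi> x X = (\<lambda>n\<in>{..<length xs}. if act x (ks ! n) then \<Phi> u (ks ! n) else 0)" if "rep x X u" for x X u
  proof -
    have "(SOME u. u \<in> X) \<in> X" using that by (simp add: rep_def some_in_eq)
    then show ?thesis using that ks_lt by (auto simp: \<phi>_def rep_def len)
  qed
  have xs_nth: "fst (xs ! n) = row_gr P (ks ! n)" "snd (xs ! n) = death (ks ! n)" if "n < length xs" for n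
    using that by (simp_all add: xs_def)
  have N_carrier: "carrier (space N x) = {f \<in> extensional {..<length xs}. \<forall>n<length xs. \<not> act x (ks ! n) \<longrightarrow> f n = 0}" for x
    unfolding N_def interval_sum_simps by (simp add: act_def xs_nth Ball_def cong: conj_cong)
  have N_ops: "f \<oplus>\<^bsub>space N x\<^esub> g = (\<lambda>n\<in>{..<length xs}. f n + g n)"
     "a \<odot>\<^bsub>space N x\<^esub> f = (\<lambda>n\<in>{..<length xs}. a * f n)" for f g a x
    unfolding N_def interval_sum_simps by simp_all
  have N_pmap: "pmap N x y f = (\<lambda>n\<in>{..<length xs}. if row_gr P (ks ! n) \<le> x \<and> ereal y < death (ks ! n) then f n else 0)" for x y f
    unfolding N_def interval_sum_simps by (rule restrict_ext) (simp add: xs_nth)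
  have lin: "linear_map class_ring (space (presented_module P) x) (space N x) (\<phi> x)" for x
  proof (rule linear_mapI[OF vs])
    show "vectorspace class_ring (space N x)" unfolding N_def by (rule vectorspace_interval_sum)
    show "\<phi> x \<in> carrier (space (presented_module P) x) \<rightarrow> carrier (space N x)"
      by (auto simp: N_carrier \<phi>_def)
  next
    fix X Y assume "X \<in> carrier (space (presented_module P) x)" "Y \<in> carrier (space (presented_module P) x)"
    then obtain u v where uv: "rep x X u" "rep x Y v" unfolding M_carrier using rep_coset gen_carr by blast
    then have "u \<in> carrier_vec k" "v \<in> carrier_vec k" by (simp_all add: rep_def)
    then show "\<phi> x (X \<oplus>\<^bsub>space (presented_module P) x\<^esub> Y) = \<phi> x X \<oplus>\<^bsub>space N x\<^esub> \<phi> x Y"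
      unfolding M_add N_ops \<phi>_eq[OF rep_add[OF uv]] \<phi>_eq[OF uv(1)] \<phi>_eq[OF uv(2)]
      using ks_lt by (intro restrict_ext) (auto simp: len add)
  next
    fix a X assume "X \<in> carrier (space (presented_module P) x)"
    then obtain u where u: "rep x X u" unfolding M_carrier using rep_coset gen_carr by blast
    then have uc: "u \<in> carrier_vec k" by (simp add: rep_def)
    have au: "rep x (\<Union>v\<in>X. coset x (a \<cdot>\<^sub>v v)) (a \<cdot>\<^sub>v u)"
      by (rule rep_UN) (use u in \<open>auto simp: rep_def scale\<close>)
    show "\<phi> x (a \<odot>\<^bsub>space (presented_module P) x\<^esub> X) = a \<odot>\<^bsub>space N x\<^esub> \<phi> x X"
      unfolding M_smult N_ops \<phi>_eq[OF au] \<phi>_eq[OF u]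
      using ks_lt uc by (intro restrict_ext) (auto simp: len scale)
  qed
  have coset_eq: "coset x u = coset x v"
    if "u \<in> pres_gens P x" "v \<in> pres_gens P x" "\<And>n. n < length ks \<Longrightarrow> act x (ks ! n) \<Longrightarrow> \<Phi> u (ks ! n) = \<Phi> v (ks ! n)" for x u v
  proof -
    have uv: "u \<in> carrier_vec k" "v \<in> carrier_vec k" using that gen_carr by auto
    have "u' + p \<in> coset x q" if pq: "p \<in> pres_gens P x" "q \<in> pres_gens P x" "u' \<in> pres_rels P x"
      "\<And>n. n < length ks \<Longrightarrow> act x (ks ! n) \<Longrightarrow> \<Phi> p (ks ! n) = \<Phi> q (ks ! n)" for p q u'
    proof -
      have c: "p \<in> carrier_vec k" "q \<in> carrier_vec k" "u' \<in> carrier_vec k" using pq gen_carr rel_carr by auto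
      have eq: "\<Phi> (u' + (p - q)) i = \<Phi> u' i + (\<Phi> p i - \<Phi> q i)" if "i < k" for i
        using that c coordinates_diff[OF co c(1,2) that] by (simp add: add)
      have "i \<in> T \<and> col_gr P (d i) \<le> x" if i: "i < k" "\<Phi> (u' + (p - q)) i \<noteq> 0" for i
      proof (cases "\<Phi> p i - \<Phi> q i = 0")
        case True
        then show ?thesis using i eq pq(3) by (simp add: rels)
      next
        case False
        then have "\<not> act x i" using act_ks[OF _ i(1), of x] pq(4) by force
        moreover have "row_gr P i \<le> x" using False pq(1,2) i(1) by (auto simp: gens)
        ultimately show ?thesis by (auto simp: act_def death_def split: if_splits)
      qed
      then have "u' + (p - q) \<in> pres_rels P x" using c by (simp add: rels)
      moreover have "u' + p = (u' + (p - q)) + q" using c by (intro eq_vecI) auto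
      ultimately show ?thesis by (auto simp: coset_def)
    qed
    then show ?thesis using that by (auto simp: coset_def) 
  qed
  have bij: "bij_betw (\<phi> x) (carrier (space (presented_module P) x)) (carrier (space N x))" for x
    unfolding bij_betw_def
  proof (intro conjI)
    show "inj_on (\<phi> x) (carrier (space (presented_module P) x))"
    proof (rule inj_onI)
    fix X Y assume X: "X \<in> carrier (space (presented_module P) x)" and Y: "Y \<in> carrier (space (presented_module P) x)"
      and eq: "\<phi> x X = \<phi> x Y"
    obtain u v where uv: "u \<in> pres_gens P x" "X = coset x u" "v \<in> pres_gens P x" "Y = coset x v"
      using X Y unfolding M_carrier by blast
    have "\<Phi> u (ks ! n) = \<Phi> v (ks ! n)" if "n < length ks" "act x (ks ! n)" for n
      using fun_cong[OF eq, of n] that uv gen_carr by (simp add: \<phi>_eq[OF rep_coset] len)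
    then show "X = Y" unfolding uv(2,4) by (rule coset_eq[OF uv(1,3)])
    qed
    show "\<phi> x ` carrier (space (presented_module P) x) = carrier (space N x)"
    proof (intro equalityI subsetI)
    fix f assume "f \<in> \<phi> x ` carrier (space (presented_module P) x)"
    then show "f \<in> carrier (space N x)" by (auto simp: N_carrier \<phi>_def)
  next
    fix f assume f: "f \<in> carrier (space N x)"
    have inj: "inj_on ((!) ks) {..<length ks}" by (rule inj_on_nth) (auto simp: ks_def)
    define h where "h i = (if act x i then f (the_inv_into {..<length ks} ((!) ks) i) else 0)" for i
    have "\<exists>u\<in>carrier_vec k. \<forall>i<k. \<Phi> u i = h i"
      using co unfolding coordinates_def by blast
    then obtain u where u: "u \<in> carrier_vec k" "\<And>i. i < k \<Longrightarrow> \<Phi> u i = h i" by blast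
    have "u \<in> pres_gens P x" using u by (auto simp: gens h_def act_def)
    moreover have "f = \<phi> x (coset x u)"
    proof (rule extensionalityI[where A = "{..<length xs}"])
      show "f n = \<phi> x (coset x u) n" if "n \<in> {..<length xs}" for n
        using that f u ks_lt the_inv_into_f_f[OF inj, of n]
        by (auto simp: \<phi>_eq[OF rep_coset[OF u(1)]] len h_def N_carrier)
    qed (use f in \<open>auto simp: \<phi>_def N_carrier\<close>)
    ultimately show "f \<in> \<phi> x ` carrier (space (presented_module P) x)" unfolding M_carrier by blast
    qed
  qed
  have natural: "\<phi> y (pmap (presented_module P) x y X) = pmap N x y (\<phi> x X)"
    if xy: "x \<le> y" and X: "X \<in> carrier (space (presented_module P) x)" for x y X
  proof -
    obtain u where u: "u \<in> pres_gens P x" "X = coset x u" using X unfolding M_carrier by blast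
    have uc: "u \<in> carrier_vec k" by (rule gen_carr[OF u(1)])
    have act_yx: "act x i" if "act y i" "row_gr P i \<le> x" for i
      using that xy unfolding act_def by (meson ereal_less_eq(3) order_le_less_trans)
    have "pres_rels P x \<subseteq> pres_rels P y" using xy by (auto simp: rels)
    then have X': "w \<in> carrier_vec k" "\<And>i. i < k \<Longrightarrow> act y i \<Longrightarrow> \<Phi> w i = \<Phi> u i" if "w \<in> X" for w
      using that rel_act[of _ y] rel_carr uc unfolding u(2) coset_def by (auto simp: add)
    have repX: "rep x X u" unfolding u(2) by (rule rep_coset[OF uc])
    have rep': "rep y (pmap (presented_module P) x y X) u"
    proof -
      have "X \<noteq> {}" using self[OF uc] unfolding u(2) by blast
      then show ?thesis unfolding M_pmap by (rule rep_UN) (use uc X' in blast)+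
    qed
    have unborn: "\<Phi> u i = 0" if "i < k" "\<not> row_gr P i \<le> x" for i using u(1) that by (auto simp: gens)
    have "(if act y i then \<Phi> u i else 0) =
        (if row_gr P i \<le> x \<and> ereal y < death i then if act x i then \<Phi> u i else 0 else 0)" if "i < k" for i
      using unborn[OF that] act_yx[of i] xy unfolding act_def by auto
    then show ?thesis
      unfolding N_pmap \<phi>_eq[OF rep'] \<phi>_eq[OF repX]
      using ks_lt by (intro restrict_ext) (simp add: len)
  qed
  have "mset xs = bars k T (row_gr P) (\<lambda>i. col_gr P (d i))"
  proof -
    have "mset ks = mset_set {i. i < k \<and> (i \<in> T \<longrightarrow> row_gr P i < col_gr P (d i))}"
      unfolding ks_def mset_filter mset_upt by (auto simp: filter_mset_mset_set death_def intro!: arg_cong[of _ _ mset_set])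
    then show ?thesis by (simp add: xs_def bars_def death_def image_mset.compositionality comp_def)
  qed
  moreover have "presented_module P \<cong>\<^sub>p N" unfolding pmod_iso_def using lin bij natural by blast
  moreover have "ereal b < e" if "(b, e) \<in> set xs" for b e using that by (auto simp: xs_def ks_def)
  ultimately show ?thesis unfolding is_diagram_def N_def k_def by (metis (no_types, lifting) case_prodI2 set_mset_mset)
qed

section \<open>Slices and the bottleneck distance on a cell\<close>

text \<open>The point of the slice at which it enters the quadrant above \<open>p\<close>, in the isometric parameter.\<close>

fun push :: "real \<times> real \<Rightarrow> real \<times> real \<Rightarrow> real" where
  "push (s, t) p = max (fst p * sqrt (1 + s\<^sup>2)) ((snd p - t) * sqrt (1 + s\<^sup>2) / s)"

lemma le_slice_point_iff:
  assumes "l \<in> slices"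
  shows "p \<le> slice_point l x \<longleftrightarrow> push l p \<le> x"
proof -
  obtain s t where l: "l = (s, t)" "s > 0" using assms by (auto simp: slices_def)
  define w where "w = sqrt (1 + s\<^sup>2)"
  have w: "w > 0" by (simp add: w_def add_pos_nonneg)
  show ?thesis
    using l(2) w unfolding l(1) less_eq_prod_def slice_point.simps push.simps w_def[symmetric]
    by (simp add: field_simps)
qed

lemma slice_point_mono:
  assumes "l \<in> slices" "x \<le> y"
  shows "slice_point l x \<le> slice_point l y"
proof -
  obtain s t where l: "l = (s, t)" "s > 0" using assms(1) by (auto simp: slices_def)
  have "x / sqrt (1 + s\<^sup>2) \<le> y / sqrt (1 + s\<^sup>2)" "s * x / sqrt (1 + s\<^sup>2) \<le> s * y / sqrt (1 + s\<^sup>2)"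
    using assms(2) l(2) by (auto intro!: divide_right_mono mult_left_mono)
  then show ?thesis by (simp add: l(1) less_eq_prod_def)
qed

lemma slice_presented_module:
  assumes "l \<in> slices"
  shows "slice_module (presented_module P) l = presented_module (regrade (push l) P)"
proof -
  have "pres_gens P (slice_point l x) = pres_gens (regrade (push l) P) x"
    "pres_rels P (slice_point l x) = pres_rels (regrade (push l) P) x" for x
    by (simp_all add: pres_gens_def pres_rels_def regrade_def le_slice_point_iff[OF assms])
  then show ?thesis by (simp add: slice_module_def presented_module_def) (simp add: regrade_def)
qed

lemma slice_module_iso:
  assumes "M \<cong>\<^sub>p N" "l \<in> slices"
  shows "slice_module M l \<cong>\<^sub>p slice_module N l"
proof -
  obtain \<phi> where "\<And>p. linear_map class_ring (space M p) (space N p) (\<phi> p)"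
      "\<And>p. bij_betw (\<phi> p) (carrier (space M p)) (carrier (space N p))"
      "\<And>p q v. p \<le> q \<Longrightarrow> v \<in> carrier (space M p) \<Longrightarrow> \<phi> q (pmap M p q v) = pmap N p q (\<phi> p v)"
    using assms(1) unfolding pmod_iso_def by blast
  then show ?thesis
    unfolding pmod_iso_def slice_module_def
    by (intro exI[of _ "\<lambda>x. \<phi> (slice_point l x)"]) (auto simp: slice_point_mono[OF assms(2)])
qed

lemma persistence_module_slice:
  assumes "persistence_module M" "l \<in> slices"
  shows "persistence_module (slice_module M l)"
proof -
  interpret persistence_module M by (rule assms(1))
  show ?thesis
    unfolding persistence_module_def slice_module_def pmod.simps
    using vectorspace_space linear_pmap pmap_id pmap_comp slice_point_mono[OF assms(2)] by simp
qed

text \<open>A symbolic bar is given by the grade of its birth and, if it dies, the grade of its death. It becomes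
  an actual bar on each slice once the grades are pushed to that slice.\<close>

definition bar_at :: "('q \<Rightarrow> real) \<Rightarrow> 'q \<times> 'q option \<Rightarrow> real \<times> ereal" where
  "bar_at g b = (g (fst b), case snd b of None \<Rightarrow> \<infinity> | Some q \<Rightarrow> ereal (g q))"

definition bars_in :: "'q set \<Rightarrow> ('q \<times> 'q option) multiset \<Rightarrow> bool" where
  "bars_in G L \<longleftrightarrow> (\<forall>(p, e) \<in># L. p \<in> G \<and> set_option e \<subseteq> G)"

text \<open>The persistence pairing depends on a slice only through the order in which the pushed grades
  appear on it.\<close>

lemma symbolic_diagram:
  fixes M :: "(real \<times> real, 'k::{field, finite}, 'v) pmod"
  assumes M: "persistence_module M" and P: "presents P M" and l0: "l\<^sub>0 \<in> slices"
  obtains L where "bars_in (grades P) L"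
    "\<And>l. l \<in> slices \<Longrightarrow> same_order (grades P) (push l\<^sub>0) (push l) \<Longrightarrow>
      diagram (slice_module M l) = image_mset (bar_at (push l)) L"
proof -
  let ?k = "dim_row (pmat P)"
  obtain \<Phi> T d where sp0: "splits (regrade (push l\<^sub>0) P) \<Phi> T d" using splits_exists by blast
  then have T: "T \<subseteq> {..<?k}" "d ` T \<subseteq> {..<dim_col (pmat P)}" by (auto simp: splits_def regrade_def)
  define I where "I = {i. i < ?k \<and> (i \<in> T \<longrightarrow> push l\<^sub>0 (row_gr P i) < push l\<^sub>0 (col_gr P (d i)))}"
  define L where "L = image_mset (\<lambda>i. (row_gr P i, if i \<in> T then Some (col_gr P (d i)) else None)) (mset_set I)"
  have "finite I" by (simp add: I_def)
  then have L: "bars_in (grades P) L"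
    using T by (auto simp: bars_in_def L_def grades_def I_def)
  have "diagram (slice_module M l) = image_mset (bar_at (push l)) L"
    if l: "l \<in> slices" and ord: "same_order (grades P) (push l\<^sub>0) (push l)" for l
  proof (rule diagram_eqI)
    show "persistence_module (slice_module M l)" by (rule persistence_module_slice[OF M l])
    have iso: "slice_module M l \<cong>\<^sub>p presented_module (regrade (push l) P)"
      using slice_module_iso[of M "presented_module P" l] P l by (simp add: presents_def slice_presented_module)
    then have vs: "vectorspace class_ring (space (presented_module (regrade (push l) P)) x)" for x
      unfolding pmod_iso_def using linear_mapD(2) by blast
    have sp: "splits (regrade (push l) P) \<Phi> T d"
      by (rule splits_transfer[OF ord sp0])
    have "push l (row_gr P i) < push l (col_gr P (d i)) \<longleftrightarrow> push l\<^sub>0 (row_gr P i) < push l\<^sub>0 (col_gr P (d i))"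
      if "i \<in> T" for i
    proof -
      have "row_gr P i \<in> grades P" "col_gr P (d i) \<in> grades P" using that T by (auto simp: grades_def)
      then show ?thesis using ord by (auto simp: same_order_def simp flip: not_le)
    qed
    then have "I = {i. i < ?k \<and> (i \<in> T \<longrightarrow> push l (row_gr P i) < push l (col_gr P (d i)))}"
      by (auto simp: I_def)
    then have "bars ?k T (push l \<circ> row_gr P) (\<lambda>i. push l (col_gr P (d i))) = image_mset (bar_at (push l)) L"
      by (auto simp: bars_def L_def bar_at_def image_mset.compositionality comp_def intro!: image_mset_cong)
    then show "is_diagram (slice_module M l) (image_mset (bar_at (push l)) L)"
      using is_diagram_iso[OF iso is_diagram_of_splits[OF sp vs]] by (simp add: regrade_def)
  qed
  then show ?thesis using that L by blast
qed

definition pair_cost :: "(real \<times> ereal) \<times> (real \<times> ereal) \<Rightarrow> ereal" where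
  "pair_cost = (\<lambda>((a, b), (c, d)). max (ereal \<bar>a - c\<bar>) (endpoint_dist b d))"

definition half_length :: "real \<times> ereal \<Rightarrow> ereal" where
  "half_length = (\<lambda>(a, b). (b - ereal a) / 2)"

lemma matching_cost_eq:
  "matching_cost D1 D2 \<sigma> = max (Max (insert 0 (pair_cost ` set_mset \<sigma>)))
     (Max (insert 0 (half_length ` set_mset ((D1 - image_mset fst \<sigma>) + (D2 - image_mset snd \<sigma>)))))"
  unfolding matching_cost_def matched_cost_def unmatched_cost_def pair_cost_def half_length_def ..

lemma le_matching_cost_iff:
  "z \<le> matching_cost D1 D2 \<sigma> \<longleftrightarrow> z \<le> 0 \<or> (\<exists>u\<in>#\<sigma>. z \<le> pair_cost u) \<or>
     (\<exists>u\<in>#(D1 - image_mset fst \<sigma>) + (D2 - image_mset snd \<sigma>). z \<le> half_length u)"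
  unfolding matching_cost_eq le_max_iff_disj
  by (subst (1 2) Max_ge_iff) (auto simp del: set_mset_union)

text \<open>A matching of \<open>D1\<close> and \<open>D2\<close> is carried by \<open>R\<close> to a matching of the images, with corresponding terms in
  its cost. A lower bound for the images therefore comes back to \<open>D1\<close> and \<open>D2\<close>, provided that it does so
  term by term.\<close>

lemma bottleneck_pullback:
  fixes R :: "real \<times> ereal \<Rightarrow> real \<times> ereal"
  assumes z: "z \<le> bottleneck_diagrams (image_mset R D1) (image_mset R D2)"
    and matched: "\<And>u v. u \<in># D1 \<Longrightarrow> v \<in># D2 \<Longrightarrow> z \<le> pair_cost (R u, R v) \<Longrightarrow> z' \<le> pair_cost (u, v)"
    and unmatched: "\<And>u. u \<in># D1 + D2 \<Longrightarrow> z \<le> half_length (R u) \<Longrightarrow> z' \<le> half_length u"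
    and zero: "z \<le> 0 \<Longrightarrow> z' \<le> 0"
  shows "z' \<le> bottleneck_diagrams D1 D2"
  unfolding bottleneck_diagrams_def
proof (rule INF_greatest)
  fix \<sigma> assume "\<sigma> \<in> {\<sigma>. is_matching D1 D2 \<sigma>}"
  then have \<sigma>: "image_mset fst \<sigma> \<subseteq># D1" "image_mset snd \<sigma> \<subseteq># D2" by (auto simp: is_matching_def)
  define \<tau> where "\<tau> = image_mset (map_prod R R) \<sigma>"
  have \<tau>: "image_mset fst \<tau> = image_mset R (image_mset fst \<sigma>)" "image_mset snd \<tau> = image_mset R (image_mset snd \<sigma>)"
    by (simp_all add: \<tau>_def image_mset.compositionality comp_def)
  have "is_matching (image_mset R D1) (image_mset R D2) \<tau>"
    unfolding is_matching_def \<tau> using \<sigma> by (simp add: image_mset_subseteq_mono)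
  then have "z \<le> matching_cost (image_mset R D1) (image_mset R D2) \<tau>"
    using z unfolding bottleneck_diagrams_def by (meson INF_lower mem_Collect_eq order_trans)
  then consider "z \<le> 0" | u where "u \<in># \<sigma>" "z \<le> pair_cost (map_prod R R u)"
    | u where "u \<in># (D1 - image_mset fst \<sigma>) + (D2 - image_mset snd \<sigma>)" "z \<le> half_length (R u)"
    unfolding le_matching_cost_iff \<tau> image_mset_Diff[OF \<sigma>(1), symmetric] image_mset_Diff[OF \<sigma>(2), symmetric]
      image_mset_union[symmetric] unfolding \<tau>_def set_image_mset
    by (simp only: bex_simps) blast
  then show "z' \<le> matching_cost D1 D2 \<sigma>"
  proof cases
    case 1
    then show ?thesis using zero by (simp add: le_matching_cost_iff)
  next
    case (2 u)
    have "fst u \<in># D1" "snd u \<in># D2" using \<sigma> 2(1) by (auto dest!: mset_subset_eqD)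
    then have "z' \<le> pair_cost u" using matched[of "fst u" "snd u"] 2(2) by (simp add: map_prod_def split_beta)
    then show ?thesis using 2(1) unfolding le_matching_cost_iff by blast
  next
    case (3 u)
    then have "u \<in># D1 + D2" by (auto dest: in_diffD)
    then show ?thesis using unmatched 3 unfolding le_matching_cost_iff by blast
  qed
qed

lemma bottleneck_attained:
  "bottleneck_diagrams D1 D2 \<in> insert 0 (pair_cost ` (set_mset D1 \<times> set_mset D2) \<union> half_length ` set_mset (D1 + D2))"
    (is "_ \<in> ?V")
proof -
  have "matching_cost D1 D2 \<sigma> \<in> ?V" if "is_matching D1 D2 \<sigma>" for \<sigma>
  proof -
    have sub: "set_mset \<sigma> \<subseteq> set_mset D1 \<times> set_mset D2"
      using that by (force simp: is_matching_def dest: mset_subset_eqD)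
    define X where "X = insert 0 (pair_cost ` set_mset \<sigma>)"
    define Y where "Y = insert 0 (half_length ` set_mset ((D1 - image_mset fst \<sigma>) + (D2 - image_mset snd \<sigma>)))"
    have "Max X \<in> X" "Max Y \<in> Y" unfolding X_def Y_def by (rule Max_in; simp)+
    moreover have "set_mset ((D1 - image_mset fst \<sigma>) + (D2 - image_mset snd \<sigma>)) \<subseteq> set_mset (D1 + D2)"
      by (auto dest: in_diffD)
    ultimately have "Max X \<in> ?V" "Max Y \<in> ?V" using sub unfolding X_def Y_def by blast+
    then show ?thesis unfolding matching_cost_eq X_def[symmetric] Y_def[symmetric] max_def by simp
  qed
  then have sub: "matching_cost D1 D2 ` {\<sigma>. is_matching D1 D2 \<sigma>} \<subseteq> ?V" by blast
  have fin: "finite (matching_cost D1 D2 ` {\<sigma>. is_matching D1 D2 \<sigma>})" by (rule finite_subset[OF sub]) auto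
  have "is_matching D1 D2 {#}" by (simp add: is_matching_def)
  then have ne: "matching_cost D1 D2 ` {\<sigma>. is_matching D1 D2 \<sigma>} \<noteq> {}" by blast
  show ?thesis unfolding bottleneck_diagrams_def
    using Min_in[OF fin ne] Min_Inf[OF fin ne] sub by auto
qed

text \<open>The finitely many expressions in the pushed grades that can be the cost of a matching of finite cost.\<close>

definition cost_terms :: "'q set \<Rightarrow> (('q \<Rightarrow> real) \<Rightarrow> real) set" where
  "cost_terms G = insert (\<lambda>g. 0) ((\<lambda>(p, q) g. \<bar>g p - g q\<bar>) ` (G \<times> G) \<union> (\<lambda>(p, q) g. (g p - g q) / 2) ` (G \<times> G))"

lemma cost_termsI:
  assumes "p \<in> G" "q \<in> G"
  shows "(\<lambda>g. \<bar>g p - g q\<bar>) \<in> cost_terms G" "(\<lambda>g. (g p - g q) / 2) \<in> cost_terms G"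
  using assms unfolding cost_terms_def by auto

lemma zero_cost_term: "(\<lambda>g. 0) \<in> cost_terms G"
  by (simp add: cost_terms_def)

lemma endpoint_dist_simps:
  "endpoint_dist (ereal a) (ereal b) = ereal \<bar>a - b\<bar>" "endpoint_dist \<infinity> \<infinity> = 0"
  "endpoint_dist (ereal a) \<infinity> = \<infinity>" "endpoint_dist \<infinity> (ereal a) = \<infinity>"
  by (auto simp: endpoint_dist_def)

lemma half_length_bar_at:
  "half_length (bar_at g (p, Some q)) = ereal ((g q - g p) / 2)" "half_length (bar_at g (p, None)) = \<infinity>"
  by (simp_all add: half_length_def bar_at_def)

lemma pair_cost_bar_at_Some:
  "pair_cost (bar_at g (p, Some p'), bar_at g (q, Some q')) = max (ereal \<bar>g p - g q\<bar>) (ereal \<bar>g p' - g q'\<bar>)"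
  "pair_cost (bar_at g (p, None), bar_at g (q, None)) = max (ereal \<bar>g p - g q\<bar>) 0"
  "pair_cost (bar_at g (p, Some p'), bar_at g (q, None)) = \<infinity>"
  "pair_cost (bar_at g (p, None), bar_at g (q, Some q')) = \<infinity>"
  by (simp_all add: pair_cost_def bar_at_def endpoint_dist_simps)

lemma bottleneck_symbolic_attained:
  assumes L: "bars_in G L1" "bars_in G L2"
    and fin: "bottleneck_diagrams (image_mset (bar_at g) L1) (image_mset (bar_at g) L2) < \<infinity>"
  shows "\<exists>e\<in>cost_terms G. bottleneck_diagrams (image_mset (bar_at g) L1) (image_mset (bar_at g) L2) = ereal (e g)"
proof -
  let ?B = "bottleneck_diagrams (image_mset (bar_at g) L1) (image_mset (bar_at g) L2)"
  consider "?B = 0" | u v where "u \<in># L1" "v \<in># L2" "?B = pair_cost (bar_at g u, bar_at g v)"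
    | u where "u \<in># L1 + L2" "?B = half_length (bar_at g u)"
    using bottleneck_attained[of "image_mset (bar_at g) L1" "image_mset (bar_at g) L2"]
    by (auto simp del: set_mset_union simp flip: image_mset_union)
  then show ?thesis
  proof cases
    case 1
    then show ?thesis using zero_cost_term by (intro bexI[of _ "\<lambda>g. 0"]) (auto simp: zero_ereal_def)
  next
    case (2 u v)
    obtain p p' q q' where uv: "u = (p, p')" "v = (q, q')" by (cases u; cases v)
    have G: "p \<in> G" "q \<in> G" "set_option p' \<subseteq> G" "set_option q' \<subseteq> G" using L 2 uv by (auto simp: bars_in_def)
    show ?thesis
    proof (cases p'; cases q')
      assume pq: "p' = None" "q' = None"
      show ?thesis using 2(3) G cost_termsI(1)[of p G q] unfolding uv pq pair_cost_bar_at_Some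
        by (intro bexI[of _ "\<lambda>g. \<bar>g p - g q\<bar>"]) (auto simp: max_def)
    next
      fix a b assume pq: "p' = Some a" "q' = Some b"
      show ?thesis
        using 2(3) G cost_termsI(1)[of p G q] cost_termsI(1)[of a G b] unfolding uv pq pair_cost_bar_at_Some max_def
        by (cases "ereal \<bar>g p - g q\<bar> \<le> ereal \<bar>g a - g b\<bar>") auto
    qed (use 2(3) fin in \<open>auto simp: uv pair_cost_bar_at_Some\<close>)
  next
    case (3 u)
    obtain p q where u: "u = (p, Some q)"
      using 3(2) fin half_length_bar_at(2)[of g "fst u"] by (cases u; cases "snd u") auto
    have "p \<in> G" "q \<in> G" using L 3(1) by (auto simp: u bars_in_def)
    then show ?thesis using 3(2) cost_termsI(2)[of q G p] unfolding u half_length_bar_at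
      by (intro bexI[of _ "\<lambda>g. (g q - g p) / 2"]) auto
  qed
qed

text \<open>If \<open>g\<close> and \<open>g'\<close> order the grades alike, \<open>g' p \<mapsto> g p\<close> is a well-defined map on endpoints, along
  which lower bounds can be pulled back.\<close>

lemma bottleneck_symbolic_mono:
  assumes L: "bars_in G L1" "bars_in G L2" and ord: "same_order G g g'"
    and z: "ereal z \<le> bottleneck_diagrams (image_mset (bar_at g) L1) (image_mset (bar_at g) L2)"
    and terms: "\<And>e. e \<in> cost_terms G \<Longrightarrow> z \<le> e g \<Longrightarrow> z' \<le> e g'"
  shows "ereal z' \<le> bottleneck_diagrams (image_mset (bar_at g') L1) (image_mset (bar_at g') L2)"
proof -
  define \<rho> where "\<rho> x = g (SOME p. p \<in> G \<and> g' p = x)" for x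
  have \<rho>: "\<rho> (g' p) = g p" if "p \<in> G" for p
  proof -
    have "\<exists>q. q \<in> G \<and> g' q = g' p" using that by blast
    then have "(SOME q. q \<in> G \<and> g' q = g' p) \<in> G \<and> g' (SOME q. q \<in> G \<and> g' q = g' p) = g' p" by (rule someI_ex)
    moreover define q where "q = (SOME q. q \<in> G \<and> g' q = g' p)"
    ultimately have q: "q \<in> G" "g' q = g' p" by simp_all
    have "g q \<le> g p \<longleftrightarrow> g' q \<le> g' p" "g p \<le> g q \<longleftrightarrow> g' p \<le> g' q"
      using ord q(1) that unfolding same_order_def by blast+
    then have "g q = g p" using q(2) by simp
    then show ?thesis by (simp add: \<rho>_def q_def)
  qed
  define R where "R = (\<lambda>(a, b). (\<rho> a, if b = \<infinity> then \<infinity> else ereal (\<rho> (real_of_ereal b))))"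
  have R: "R (bar_at g' u) = bar_at g u" if "u \<in># L1 + L2" for u
    using that L \<rho> by (cases u; cases "snd u") (auto simp: R_def bar_at_def bars_in_def)
  have img: "image_mset (bar_at g) L1 = image_mset R (image_mset (bar_at g') L1)"
     "image_mset (bar_at g) L2 = image_mset R (image_mset (bar_at g') L2)"
    using R by (auto simp: image_mset.compositionality intro!: image_mset_cong)
  show ?thesis
  proof (rule bottleneck_pullback)
    show "ereal z \<le> bottleneck_diagrams (image_mset R (image_mset (bar_at g') L1)) (image_mset R (image_mset (bar_at g') L2))"
      using z unfolding img .
  next
    fix x y assume "x \<in># image_mset (bar_at g') L1" "y \<in># image_mset (bar_at g') L2" and le: "ereal z \<le> pair_cost (R x, R y)"
    then obtain u v where uv: "u \<in># L1" "v \<in># L2" "x = bar_at g' u" "y = bar_at g' v" by auto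
    then have le': "ereal z \<le> pair_cost (bar_at g u, bar_at g v)" using le R by simp
    obtain p p' q q' where pq: "u = (p, p')" "v = (q, q')" by (cases u; cases v)
    have G: "p \<in> G" "q \<in> G" "set_option p' \<subseteq> G" "set_option q' \<subseteq> G" using L uv pq by (auto simp: bars_in_def)
    show "ereal z' \<le> pair_cost (x, y)"
      using le' G terms[OF cost_termsI(1)[of p G q]] terms[OF cost_termsI(1)[of "the p'" G "the q'"]] terms[OF zero_cost_term]
      unfolding uv(3,4) pq
      by (cases p'; cases q') (auto simp: pair_cost_bar_at_Some le_max_iff_disj zero_ereal_def)
  next
    fix x assume "x \<in># image_mset (bar_at g') L1 + image_mset (bar_at g') L2" and le: "ereal z \<le> half_length (R x)"
    then obtain u where u: "u \<in># L1 + L2" "x = bar_at g' u" by auto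
    then have le': "ereal z \<le> half_length (bar_at g u)" using le R by simp
    obtain p p' where p: "u = (p, p')" by (cases u)
    have G: "p \<in> G" "set_option p' \<subseteq> G" using L u p by (auto simp: bars_in_def)
    show "ereal z' \<le> half_length x"
    proof (cases p')
      case None
      then show ?thesis unfolding u(2) p by (simp add: half_length_bar_at)
    next
      case (Some q)
      then show ?thesis using le' G terms[OF cost_termsI(2)[of q G p]] unfolding u(2) p by (simp add: half_length_bar_at)
    qed
  next
    assume "ereal z \<le> 0"
    then show "ereal z' \<le> 0" using terms[OF zero_cost_term] by (simp add: zero_ereal_def)
  qed
qed

lemma same_order_subset: "same_order G g g' \<Longrightarrow> H \<subseteq> G \<Longrightarrow> same_order H g g'"
  unfolding same_order_def by blast

text \<open>The link between modules and piecewise linear geometry: the bottleneck distance is one of the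
  cost terms, and where the order of grades and of cost terms stays the same, this term remains a
  lower bound.\<close>

lemma bottleneck_slice_cell:
  fixes M :: "(real \<times> real, 'k::{field, finite}, 'v) pmod" and N :: "(real \<times> real, 'k, 'w) pmod"
  assumes M: "persistence_module M" "presents PM M" and N: "persistence_module N" "presents PN N"
    and l: "l \<in> slices" and fin: "bottleneck_dist (slice_module M l) (slice_module N l) < \<infinity>"
  defines "G \<equiv> grades PM \<union> grades PN"
  obtains e where "e \<in> cost_terms G" "bottleneck_dist (slice_module M l) (slice_module N l) = ereal (e (push l))"
    "\<And>l'. l' \<in> slices \<Longrightarrow> same_order G (push l) (push l') \<Longrightarrow>
       (\<And>e'. e' \<in> cost_terms G \<Longrightarrow> e (push l) \<le> e' (push l) \<Longrightarrow> e (push l') \<le> e' (push l')) \<Longrightarrow>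
       ereal (e (push l')) \<le> bottleneck_dist (slice_module M l') (slice_module N l')"
proof -
  obtain L1 where L1: "bars_in (grades PM) L1"
    "\<And>l'. l' \<in> slices \<Longrightarrow> same_order (grades PM) (push l) (push l') \<Longrightarrow>
      diagram (slice_module M l') = image_mset (bar_at (push l')) L1"
    using symbolic_diagram[OF M l] by blast
  obtain L2 where L2: "bars_in (grades PN) L2"
    "\<And>l'. l' \<in> slices \<Longrightarrow> same_order (grades PN) (push l) (push l') \<Longrightarrow>
      diagram (slice_module N l') = image_mset (bar_at (push l')) L2"
    using symbolic_diagram[OF N l] by blast
  have bars: "bars_in G L1" "bars_in G L2" using L1(1) L2(1) by (fastforce simp: bars_in_def G_def)+
  have B: "bottleneck_dist (slice_module M l') (slice_module N l') =
      bottleneck_diagrams (image_mset (bar_at (push l')) L1) (image_mset (bar_at (push l')) L2)"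
    if "l' \<in> slices" "same_order G (push l) (push l')" for l'
    using that L1(2) L2(2) same_order_subset[OF that(2)] unfolding bottleneck_dist_def G_def by simp
  have refl: "same_order G (push l) (push l)" by (simp add: same_order_def)
  obtain e where e: "e \<in> cost_terms G" "bottleneck_dist (slice_module M l) (slice_module N l) = ereal (e (push l))"
    using bottleneck_symbolic_attained[OF bars, of "push l"] fin unfolding B[OF l refl] by blast
  show ?thesis
  proof (rule that[OF e])
    fix l' assume l': "l' \<in> slices" "same_order G (push l) (push l')"
      and "\<And>e'. e' \<in> cost_terms G \<Longrightarrow> e (push l) \<le> e' (push l) \<Longrightarrow> e (push l') \<le> e' (push l')"
    then show "ereal (e (push l')) \<le> bottleneck_dist (slice_module M l') (slice_module N l')"
      unfolding B[OF l'] using bottleneck_symbolic_mono[OF bars l'(2), of "e (push l)"] e(2) B[OF l refl] by simp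
  qed
qed

section \<open>Piecewise linearity of the weighted distance\<close>

text \<open>The parameters \<open>(a, c)\<close> with \<open>0 < a \<le> 1\<close> describe the slices of slope \<open>1 / a \<ge> 1\<close>, and with the roles of the
  axes exchanged those of slope \<open>a \<le> 1\<close>. In these parameters the weighted push becomes piecewise linear,
  up to a constant that no difference of pushed grades sees: the weight cancels the square roots.\<close>

fun height :: "bool \<Rightarrow> real \<times> real \<Rightarrow> real \<times> real \<Rightarrow> real" where
  "height b (a, c) p = (if b then max (fst p) (a * snd p - c) else max (snd p) (a * fst p - c))"

fun slice_of :: "bool \<Rightarrow> real \<times> real \<Rightarrow> real \<times> real" where
  "slice_of b (a, c) = (if b then (1 / a, c / a) else (a, - c))"

definition strip :: "(real \<times> real) set" where
  "strip = {(a, c). 0 < a \<and> a \<le> 1}"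

lemma slices_eq_slice_of: "slices = slice_of True ` strip \<union> slice_of False ` strip"
proof (intro equalityI subsetI)
  fix l assume "l \<in> slices"
  then obtain s t where l: "l = (s, t)" "s > 0" by (auto simp: slices_def)
  show "l \<in> slice_of True ` strip \<union> slice_of False ` strip"
  proof (cases "s \<ge> 1")
    case True
    then have "l = slice_of True (1 / s, t / s)" "(1 / s, t / s) \<in> strip" using l by (auto simp: strip_def)
    then show ?thesis by blast
  next
    case False
    then have "l = slice_of False (s, - t)" "(s, - t) \<in> strip" using l by (auto simp: strip_def)
    then show ?thesis by blast
  qed
qed (auto simp: slices_def strip_def)

lemma slice_of_in_slices: "z \<in> strip \<Longrightarrow> slice_of b z \<in> slices"
  using slices_eq_slice_of by (cases b) auto

lemma push_slice_of:
  assumes z: "z \<in> strip"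
  shows "\<exists>\<kappa>. push (slice_of b z) = (\<lambda>p. (height b z p + \<kappa>) / slice_weight (slice_of b z))"
    and "slice_weight (slice_of b z) > 0"
proof -
  obtain a c where ac: "z = (a, c)" "0 < a" "a \<le> 1" using z by (auto simp: strip_def)
  define r where "r = sqrt (1 + a\<^sup>2)"
  have r: "r > 0" by (simp add: r_def add_pos_nonneg)
  have r': "sqrt (1 + (1 / a)\<^sup>2) = r / a"
  proof -
    have "1 + (1 / a)\<^sup>2 = (1 + a\<^sup>2) / a\<^sup>2" using ac by (simp add: field_simps)
    then show ?thesis using ac by (simp add: r_def real_sqrt_divide)
  qed
  have scale: "max (k * x) (k * y) = k * max x y" if "k > 0" for k x y :: real
    using that by (simp add: max_def)
  have w: "slice_weight (slice_of b z) = a / r"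
  proof (cases b)
    case True
    then show ?thesis using ac r' by simp
  next
    case False
    have "1 / r = a / r" if "a \<ge> 1" using that ac by simp
    then show ?thesis using False ac r' by (auto simp: r_def[symmetric] power_one_over)
  qed
  show "slice_weight (slice_of b z) > 0" unfolding w using r ac by simp
  show "\<exists>\<kappa>. push (slice_of b z) = (\<lambda>p. (height b z p + \<kappa>) / slice_weight (slice_of b z))"
  proof (cases b)
    case True
    have "push (slice_of b z) p = (height b z p + 0) / (a / r)" for p
    proof -
      have "(snd p - c / a) * (r / a) / (1 / a) = (r / a) * (a * snd p - c)"
        using ac(2) by (simp add: field_simps)
      then have "push (slice_of b z) p = max ((r / a) * fst p) ((r / a) * (a * snd p - c))"
        using True by (simp only: ac(1) slice_of.simps push.simps r' if_True mult.commute[of "fst p"])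
      also have "\<dots> = (r / a) * max (fst p) (a * snd p - c)" by (rule scale) (use r ac in simp)
      finally show ?thesis using True ac by simp
    qed
    then show ?thesis unfolding w by blast
  next
    case False
    have "push (slice_of b z) p = (height b z p + c) / (a / r)" for p
    proof -
      have "push (slice_of b z) p = max ((r / a) * (a * fst p)) ((r / a) * (snd p + c))"
        using False ac r by (simp add: r_def[symmetric] field_simps)
      also have "\<dots> = (r / a) * max (a * fst p) (snd p + c)" by (rule scale) (use r ac in simp)
      also have "max (a * fst p) (snd p + c) = max (snd p) (a * fst p - c) + c" by (simp add: max_def)
      finally show ?thesis using False ac by simp
    qed
    then show ?thesis unfolding w by blast
  qed
qed

lemma cost_term_rescale:
  assumes "e \<in> cost_terms G" "w > 0"
  shows "e (\<lambda>p. (g p + \<kappa>) / w) = e g / w"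
proof -
  have "(g p + \<kappa>) / w - (g q + \<kappa>) / w = (g p - g q) / w" for p q by (simp flip: diff_divide_distrib)
  then show ?thesis using assms unfolding cost_terms_def by auto
qed

lemma cost_term_translate:
  assumes "e \<in> cost_terms G" "\<And>p. p \<in> G \<Longrightarrow> g p = g' p + \<kappa>"
  shows "e g = e g'"
  using assms unfolding cost_terms_def by auto

text \<open>Far from the grades only one of the two branches of \<open>height\<close> occurs, so moving \<open>c\<close> further changes
  all heights by the same amount. This confines the parameters to a box.\<close>

lemma height_clamp:
  assumes z: "z \<in> strip" and K: "\<And>p. p \<in> G \<Longrightarrow> \<bar>fst p\<bar> + \<bar>snd p\<bar> \<le> K" "K \<ge> 1"
  shows "\<exists>y\<in>strip. \<bar>fst y\<bar> \<le> K \<and> \<bar>snd y\<bar> \<le> K \<and> (\<exists>\<kappa>. \<forall>p\<in>G. height b z p = height b y p + \<kappa>)"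
proof -
  obtain a c where ac: "z = (a, c)" "0 < a" "a \<le> 1" using z by (auto simp: strip_def)
  have bound: "\<bar>a * fst p\<bar> \<le> \<bar>fst p\<bar>" "\<bar>a * snd p\<bar> \<le> \<bar>snd p\<bar>" for p :: "real \<times> real"
    using ac by (simp_all add: abs_mult mult_left_le_one_le)
  define y where "y = (a, max (- K) (min K c))"
  have "\<exists>\<kappa>. \<forall>p\<in>G. height b z p = height b y p + \<kappa>"
  proof -
    consider "c > K" | "c < - K" | "\<bar>c\<bar> \<le> K" by linarith
    then show ?thesis
    proof cases
      case 1
      have "height b z p = height b y p + 0" if "p \<in> G" for p
        using 1 K(1)[OF that] K(2) bound[of p] by (auto simp: ac(1) y_def)
      then show ?thesis by blast
    next
      case 2
      have "height b z p = height b y p + (- c - K)" if "p \<in> G" for p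
        using 2 K(1)[OF that] K(2) bound[of p] by (auto simp: ac(1) y_def)
      then show ?thesis by blast
    next
      case 3
      then have "y = z" by (auto simp: y_def ac)
      then show ?thesis by (intro exI[of _ 0]) simp
    qed
  qed
  moreover have "y \<in> strip" "\<bar>fst y\<bar> \<le> K" "\<bar>snd y\<bar> \<le> K" using ac K(2) by (auto simp: y_def strip_def)
  ultimately show ?thesis by blast
qed

definition to_rat :: "real \<Rightarrow> rat" where
  "to_rat x = (SOME q. of_rat q = x)"

lemma of_rat_to_rat: "x \<in> \<rat> \<Longrightarrow> of_rat (to_rat x) = x"
  unfolding to_rat_def by (rule someI_ex) (metis Rats_cases)

text \<open>The two affine forms of which \<open>height b z p\<close> is the maximum.\<close>

definition branches :: "bool \<Rightarrow> real \<times> real \<Rightarrow> (rat \<times> rat \<times> rat) set" where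
  "branches b p = (if b then {(to_rat (fst p), 0, 0), (0, to_rat (snd p), -1)}
     else {(to_rat (snd p), 0, 0), (0, to_rat (fst p), -1)})"

definition cost_forms :: "bool \<Rightarrow> (real \<times> real) set \<Rightarrow> (rat \<times> rat \<times> rat) set" where
  "cost_forms b G = (let H = \<Union>p\<in>G. branches b p in
     insert 0 ((\<lambda>(g, h). g - h) ` (H \<times> H) \<union> (\<lambda>((g0, g1, g2), (h0, h1, h2)). ((g0 - h0) / 2, (g1 - h1) / 2, (g2 - h2) / 2)) ` (H \<times> H)))"

text \<open>Their signs decide which branch each height takes, the signs of all height differences, and the
  order of the cost terms. The first two forms bound the strip.\<close>

definition cell_forms :: "bool \<Rightarrow> (real \<times> real) set \<Rightarrow> (rat \<times> rat \<times> rat) set" where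
  "cell_forms b G = {(0, 1, 0), (1, -1, 0)} \<union> (\<lambda>(g, h). g - h) ` (cost_forms b G \<times> cost_forms b G)"

lemma finite_cost_forms: "finite G \<Longrightarrow> finite (cost_forms b G)"
  by (auto simp: cost_forms_def branches_def Let_def)

lemma finite_cell_forms: "finite G \<Longrightarrow> finite (cell_forms b G)"
  by (auto simp: cell_forms_def finite_cost_forms)

definition same_cell :: "bool \<Rightarrow> (real \<times> real) set \<Rightarrow> real \<times> real \<Rightarrow> real \<times> real \<Rightarrow> bool" where
  "same_cell b G z z' \<longleftrightarrow> (\<forall>g\<in>cell_forms b G. sgn (aff g z') = sgn (aff g z))"

lemma aff_zero: "aff 0 z = 0"
  by (simp add: aff_def zero_prod_def)

lemma sgn_eq_le_iff:
  fixes x y :: real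
  assumes "sgn x = sgn y"
  shows "0 \<le> x \<longleftrightarrow> 0 \<le> y"
  using assms by (auto simp: sgn_if split: if_splits)

lemma same_cell_le_iff:
  assumes "same_cell b G z z'" "g \<in> cost_forms b G" "h \<in> cost_forms b G"
  shows "aff g z' \<le> aff h z' \<longleftrightarrow> aff g z \<le> aff h z"
proof -
  have "h - g \<in> cell_forms b G" using assms(2,3) by (force simp: cell_forms_def)
  then have "sgn (aff (h - g) z') = sgn (aff (h - g) z)" using assms(1) by (simp add: same_cell_def)
  then show ?thesis using sgn_eq_le_iff[of "aff (h - g) z'" "aff (h - g) z"] by (simp add: aff_diff)
qed

lemma same_cell_strip:
  assumes "same_cell b G z z'" "z \<in> strip"
  shows "z' \<in> strip"
proof -
  obtain a c a' c' where z: "z = (a, c)" "z' = (a', c')" by (cases z; cases z')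
  have "sgn (aff (0, 1, 0) z') = sgn (aff (0, 1, 0) z)" "sgn (aff (1, -1, 0) z') = sgn (aff (1, -1, 0) z)"
    using assms(1) by (simp_all add: same_cell_def cell_forms_def)
  then show ?thesis using assms(2) by (auto simp: z aff_def strip_def sgn_if split: if_splits)
qed

context
  fixes b :: bool and G :: "(real \<times> real) set"
  assumes rat: "G \<subseteq> \<rat> \<times> \<rat>"
begin

lemma diff_branches:
  assumes "p \<in> G" "q \<in> G" "g \<in> branches b p" "h \<in> branches b q"
  shows "g - h \<in> cost_forms b G"
  unfolding cost_forms_def Let_def using assms by (intro insertI2 UnI1 rev_image_eqI[of "(g, h)"]) auto

lemma zero_cost_form: "0 \<in> cost_forms b G"
  by (simp add: cost_forms_def Let_def)

lemma branch_le_iff: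
  assumes "same_cell b G z z'" "p \<in> G" "q \<in> G" "g \<in> branches b p" "h \<in> branches b q"
  shows "aff g z' \<le> aff h z' \<longleftrightarrow> aff g z \<le> aff h z"
  using same_cell_le_iff[OF assms(1) diff_branches[OF assms(2-5)] zero_cost_form]
  by (simp add: aff_diff aff_zero)

lemma height_branch:
  assumes p: "p \<in> G"
  shows "\<exists>h\<in>branches b p. \<forall>z'. same_cell b G z z' \<longrightarrow> height b z' p = aff h z'"
proof -
  obtain g h where gh: "branches b p = {g, h}" "\<And>z. height b z p = max (aff g z) (aff h z)"
  proof -
    have "fst p \<in> \<rat>" "snd p \<in> \<rat>" using p rat by auto
    then have "height b z p = (if b then max (aff (to_rat (fst p), 0, 0) z) (aff (0, to_rat (snd p), -1) z)
       else max (aff (to_rat (snd p), 0, 0) z) (aff (0, to_rat (fst p), -1) z))" for z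
      by (cases z) (simp add: aff_def of_rat_to_rat mult.commute)
    then show ?thesis using that by (cases b) (auto simp: branches_def)
  qed
  have iff: "aff g z' \<le> aff h z' \<longleftrightarrow> aff g z \<le> aff h z" if "same_cell b G z z'" for z'
    by (rule branch_le_iff[OF that p p]) (auto simp: gh)
  show ?thesis
  proof (cases "aff g z \<le> aff h z")
    case True
    then show ?thesis using iff by (intro bexI[of _ h]) (auto simp: gh)
  next
    case False
    then show ?thesis using iff by (intro bexI[of _ g]) (auto simp: gh max_def)
  qed
qed

lemma same_cell_refl: "same_cell b G z z"
  by (simp add: same_cell_def)

lemma same_cell_same_order:
  assumes "same_cell b G z z'"
  shows "same_order G (height b z) (height b z')"
  unfolding same_order_def
proof (intro ballI)
  fix p q assume pq: "p \<in> G" "q \<in> G"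
  obtain g where g: "g \<in> branches b p" "\<And>z'. same_cell b G z z' \<Longrightarrow> height b z' p = aff g z'"
    using height_branch[OF pq(1)] by blast
  obtain h where h: "h \<in> branches b q" "\<And>z'. same_cell b G z z' \<Longrightarrow> height b z' q = aff h z'"
    using height_branch[OF pq(2)] by blast
  show "height b z p \<le> height b z q \<longleftrightarrow> height b z' p \<le> height b z' q"
    using branch_le_iff[OF assms pq g(1) h(1)] g(2) h(2) assms same_cell_refl by simp
qed

text \<open>On a cell, an absolute value opens with a fixed sign and each maximum picks a fixed branch.\<close>

lemma cost_term_form:
  assumes e: "e \<in> cost_terms G"
  shows "\<exists>w\<in>cost_forms b G. \<forall>z'. same_cell b G z z' \<longrightarrow> e (height b z') = aff w z'"
proof -
  consider "e = (\<lambda>g. 0)" | p q where "p \<in> G" "q \<in> G" "e = (\<lambda>g. \<bar>g p - g q\<bar>)"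
    | p q where "p \<in> G" "q \<in> G" "e = (\<lambda>g. (g p - g q) / 2)"
    using e unfolding cost_terms_def by auto
  then show ?thesis
  proof cases
    case 1
    then show ?thesis using zero_cost_form by (intro bexI[of _ 0]) (auto simp: aff_zero)
  next
    case (2 p q)
    obtain g where g: "g \<in> branches b p" "\<And>z'. same_cell b G z z' \<Longrightarrow> height b z' p = aff g z'"
      using height_branch[OF 2(1)] by blast
    obtain h where h: "h \<in> branches b q" "\<And>z'. same_cell b G z z' \<Longrightarrow> height b z' q = aff h z'"
      using height_branch[OF 2(2)] by blast
    have iff: "aff g z' \<le> aff h z' \<longleftrightarrow> aff g z \<le> aff h z" if "same_cell b G z z'" for z'
      by (rule branch_le_iff[OF that 2(1,2) g(1) h(1)])
    show ?thesis
    proof (cases "aff g z \<le> aff h z")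
      case True
      then show ?thesis using iff g(2) h(2) diff_branches[OF 2(2,1) h(1) g(1)]
        by (intro bexI[of _ "h - g"]) (auto simp: 2(3) aff_diff)
    next
      case False
      then show ?thesis using iff g(2) h(2) diff_branches[OF 2(1,2) g(1) h(1)]
        by (intro bexI[of _ "g - h"]) (auto simp: 2(3) aff_diff not_le intro!: abs_of_nonneg less_imp_le)
    qed
  next
    case (3 p q)
    obtain g where g: "g \<in> branches b p" "\<And>z'. same_cell b G z z' \<Longrightarrow> height b z' p = aff g z'"
      using height_branch[OF 3(1)] by blast
    obtain h where h: "h \<in> branches b q" "\<And>z'. same_cell b G z z' \<Longrightarrow> height b z' q = aff h z'"
      using height_branch[OF 3(2)] by blast
    obtain g0 g1 g2 h0 h1 h2 where gh: "g = (g0, g1, g2)" "h = (h0, h1, h2)" by (cases g; cases h)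
    have "((g0 - h0) / 2, (g1 - h1) / 2, (g2 - h2) / 2) \<in> cost_forms b G"
      unfolding cost_forms_def Let_def using 3(1,2) g(1) h(1)
      by (intro insertI2 UnI2 rev_image_eqI[of "(g, h)"]) (auto simp: gh)
    moreover have "aff ((g0 - h0) / 2, (g1 - h1) / 2, (g2 - h2) / 2) z' = (aff g z' - aff h z') / 2" for z'
      by (simp add: aff_def gh of_rat_diff of_rat_divide field_simps)
    ultimately show ?thesis using g(2) h(2) by (intro bexI) (auto simp: 3(3))
  qed
qed

end

text \<open>The supremum is the larger of the suprema over the two families of slices. The rescaling by the
  weight transports each to a function on the strip to which \<open>rational_Sup\<close> applies.\<close>

lemma rational_SUP_slices:
  fixes \<beta> :: "real \<times> real \<Rightarrow> ereal"
  assumes fin: "finite G" and rat: "G \<subseteq> \<rat> \<times> \<rat>"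
    and cell: "\<And>l. l \<in> slices \<Longrightarrow> \<exists>e\<in>cost_terms G. \<beta> l = ereal (e (push l)) \<and>
      (\<forall>l'\<in>slices. same_order G (push l) (push l') \<longrightarrow>
         (\<forall>e'\<in>cost_terms G. e (push l) \<le> e' (push l) \<longrightarrow> e (push l') \<le> e' (push l')) \<longrightarrow>
         ereal (e (push l')) \<le> \<beta> l')"
  shows "\<exists>q\<in>\<rat>. (SUP l\<in>slices. ereal (slice_weight l) * \<beta> l) = ereal q"
proof -
  have half: "\<exists>q\<in>\<rat>. (SUP l\<in>slice_of b ` strip. ereal (slice_weight l) * \<beta> l) = ereal q" for b
  proof -
    define F where "F z = real_of_ereal (ereal (slice_weight (slice_of b z)) * \<beta> (slice_of b z))" for z
    have val: "\<exists>e\<in>cost_terms G. ereal (slice_weight (slice_of b z)) * \<beta> (slice_of b z) = ereal (F z) \<and>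
        F z = e (height b z) \<and> (\<forall>z'\<in>strip. same_order G (height b z) (height b z') \<longrightarrow>
         (\<forall>e'\<in>cost_terms G. e (height b z) \<le> e' (height b z) \<longrightarrow> e (height b z') \<le> e' (height b z')) \<longrightarrow>
         e (height b z') \<le> F z')" if z: "z \<in> strip" for z
    proof -
      obtain e where e: "e \<in> cost_terms G" "\<beta> (slice_of b z) = ereal (e (push (slice_of b z)))"
        "\<And>l'. l' \<in> slices \<Longrightarrow> same_order G (push (slice_of b z)) (push l') \<Longrightarrow>
         (\<And>e'. e'\<in>cost_terms G \<Longrightarrow> e (push (slice_of b z)) \<le> e' (push (slice_of b z)) \<Longrightarrow> e (push l') \<le> e' (push l')) \<Longrightarrow>
         ereal (e (push l')) \<le> \<beta> l'"
        using cell[OF slice_of_in_slices[OF z, of b]] by blast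
      have resc: "e' (push (slice_of b y)) = e' (height b y) / slice_weight (slice_of b y)"
        if "e' \<in> cost_terms G" "y \<in> strip" for e' y
        using push_slice_of[OF that(2), of b] cost_term_rescale[OF that(1)] by metis
      have ord: "push (slice_of b y) p \<le> push (slice_of b y) q \<longleftrightarrow> height b y p \<le> height b y q"
        if y: "y \<in> strip" for y p q
      proof -
        obtain \<kappa> where "push (slice_of b y) = (\<lambda>p. (height b y p + \<kappa>) / slice_weight (slice_of b y))"
          using push_slice_of(1)[OF y] by blast
        then show ?thesis using push_slice_of(2)[OF y, of b] by (simp add: divide_le_cancel)
      qed
      have 1: "ereal (slice_weight (slice_of b z)) * \<beta> (slice_of b z) = ereal (e (height b z))"
        using push_slice_of(2)[OF z, of b] by (simp add: e(2) resc[OF e(1) z])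
      have 2: "e (height b z') \<le> F z'" if z': "z' \<in> strip" and so: "same_order G (height b z) (height b z')"
        and le: "\<And>e'. e' \<in> cost_terms G \<Longrightarrow> e (height b z) \<le> e' (height b z) \<Longrightarrow> e (height b z') \<le> e' (height b z')" for z'
      proof -
        have w: "slice_weight (slice_of b z) > 0" "slice_weight (slice_of b z') > 0"
          using push_slice_of(2) z z' by blast+
        have "ereal (e (push (slice_of b z'))) \<le> \<beta> (slice_of b z')"
        proof (rule e(3))
          show "slice_of b z' \<in> slices" by (rule slice_of_in_slices[OF z'])
          show "same_order G (push (slice_of b z)) (push (slice_of b z'))"
            using so by (simp add: same_order_def ord z z')
          show "e (push (slice_of b z')) \<le> e' (push (slice_of b z'))"
            if "e' \<in> cost_terms G" "e (push (slice_of b z)) \<le> e' (push (slice_of b z))" for e'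
            using that le[OF that(1)] w by (simp add: resc e(1) z z' divide_le_cancel)
        qed
        moreover obtain x where x: "\<beta> (slice_of b z') = ereal x" using cell[OF slice_of_in_slices[OF z', of b]] by blast
        ultimately have "e (height b z') / slice_weight (slice_of b z') \<le> x" by (simp add: resc e(1) z')
        then show ?thesis using w by (simp add: F_def x field_simps)
      qed
      show ?thesis using 1 2 e(1) by (intro bexI[of _ e]) (auto simp: F_def)
    qed
    define K where "K = 1 + (\<Sum>p\<in>G. \<bar>fst p\<bar> + \<bar>snd p\<bar>)"
    have K: "\<bar>fst p\<bar> + \<bar>snd p\<bar> \<le> K" if "p \<in> G" for p
      using member_le_sum[OF that, of "\<lambda>p. \<bar>fst p\<bar> + \<bar>snd p\<bar>"] fin by (simp add: K_def)
    have K1: "K \<ge> 1" by (simp add: K_def sum_nonneg)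
    have ne: "strip \<noteq> {}" by (auto simp: strip_def intro: exI[of _ "1/2"])
    have sup: "bdd_above (F ` strip)" "Sup (F ` strip) \<in> \<rat>"
    proof -
      have 1: "\<exists>w\<in>cost_forms b G. F z = aff w z \<and>
          (\<forall>z'. (\<forall>g\<in>cell_forms b G. sgn (aff g z') = sgn (aff g z)) \<longrightarrow> z' \<in> strip \<and> aff w z' \<le> F z')"
        if z: "z \<in> strip" for z
      proof -
        obtain e where e: "e \<in> cost_terms G" "F z = e (height b z)"
          "\<And>z'. z' \<in> strip \<Longrightarrow> same_order G (height b z) (height b z') \<Longrightarrow>
           (\<And>e'. e' \<in> cost_terms G \<Longrightarrow> e (height b z) \<le> e' (height b z) \<Longrightarrow> e (height b z') \<le> e' (height b z')) \<Longrightarrow>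
           e (height b z') \<le> F z'"
          using val[OF z] by blast
        obtain w where w: "w \<in> cost_forms b G" "\<And>z'. same_cell b G z z' \<Longrightarrow> e (height b z') = aff w z'"
          using cost_term_form[OF rat e(1)] by blast
        have "z' \<in> strip \<and> aff w z' \<le> F z'" if z': "same_cell b G z z'" for z'
        proof
          show "z' \<in> strip" by (rule same_cell_strip[OF z' z])
          then have "e (height b z') \<le> F z'"
          proof (rule e(3))
            show "same_order G (height b z) (height b z')" by (rule same_cell_same_order[OF rat z'])
            fix e' assume e': "e' \<in> cost_terms G" "e (height b z) \<le> e' (height b z)"
            obtain w' where w': "w' \<in> cost_forms b G" "\<And>z'. same_cell b G z z' \<Longrightarrow> e' (height b z') = aff w' z'"
              using cost_term_form[OF rat e'(1)] by blast
            show "e (height b z') \<le> e' (height b z')"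
              using same_cell_le_iff[OF z' w(1) w'(1)] e'(2) w(2) w'(2) z' same_cell_refl[OF rat] by simp
          qed
          then show "aff w z' \<le> F z'" using w(2)[OF z'] by simp
        qed
        then show ?thesis using w e(2) same_cell_refl[OF rat] unfolding same_cell_def by (intro bexI[of _ w]) auto
      qed
      have 2: "\<exists>y\<in>strip. \<bar>fst y\<bar> \<le> K \<and> \<bar>snd y\<bar> \<le> K \<and> F z \<le> F y" if z: "z \<in> strip" for z
      proof -
        have "\<exists>y\<in>strip. \<bar>fst y\<bar> \<le> K \<and> \<bar>snd y\<bar> \<le> K \<and> (\<exists>\<kappa>. \<forall>p\<in>G. height b z p = height b y p + \<kappa>)"
          by (rule height_clamp[OF z K K1])
        then obtain y where y: "y \<in> strip" "\<bar>fst y\<bar> \<le> K" "\<bar>snd y\<bar> \<le> K"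
          and "\<exists>\<kappa>. \<forall>p\<in>G. height b z p = height b y p + \<kappa>"
          by (elim bexE conjE)
        then obtain \<kappa> where \<kappa>: "\<And>p. p \<in> G \<Longrightarrow> height b z p = height b y p + \<kappa>"
          by (elim exE) (rule that, erule bspec)
        have tr: "e (height b z) = e (height b y)" if "e \<in> cost_terms G" for e
          by (rule cost_term_translate[OF that \<kappa>])
        have so: "same_order G (height b z) (height b y)" by (simp add: same_order_def \<kappa>)
        obtain e where e: "e \<in> cost_terms G" "F z = e (height b z)"
          "\<And>z'. z' \<in> strip \<Longrightarrow> same_order G (height b z) (height b z') \<Longrightarrow>
           (\<And>e'. e' \<in> cost_terms G \<Longrightarrow> e (height b z) \<le> e' (height b z) \<Longrightarrow> e (height b z') \<le> e' (height b z')) \<Longrightarrow>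
           e (height b z') \<le> F z'"
          using val[OF z] by blast
        have "e (height b y) \<le> F y"
        proof (rule e(3)[OF y(1) so])
          show "e (height b y) \<le> e' (height b y)"
            if "e' \<in> cost_terms G" "e (height b z) \<le> e' (height b z)" for e'
            using that(2) unfolding tr[OF e(1)] tr[OF that(1)] .
        qed
        then have "F z \<le> F y" using e(2) tr[OF e(1)] by simp
        then show ?thesis using y by blast
      qed
      show "bdd_above (F ` strip)"
        by (rule rational_Sup(1)[OF finite_cell_forms[OF fin, of b] finite_cost_forms[OF fin, of b] ne 1 2])
      show "Sup (F ` strip) \<in> \<rat>"
        by (rule rational_Sup(2)[OF finite_cell_forms[OF fin, of b] finite_cost_forms[OF fin, of b] ne 1 2])
    qed
    have "(SUP l\<in>slice_of b ` strip. ereal (slice_weight l) * \<beta> l) = (SUP z\<in>strip. ereal (F z))"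
      unfolding image_image using val by (intro SUP_cong) auto
    also have "\<dots> = ereal (Sup (F ` strip))"
    proof -
      obtain z0 where z0: "z0 \<in> strip" using ne by blast
      have "(SUP z\<in>strip. ereal (F z)) \<le> ereal (Sup (F ` strip))"
        by (rule SUP_least) (use sup(1) in \<open>auto intro: cSUP_upper\<close>)
      moreover have "ereal (F z0) \<le> (SUP z\<in>strip. ereal (F z))" by (rule SUP_upper[OF z0])
      ultimately have "\<bar>SUP z\<in>strip. ereal (F z)\<bar> \<noteq> \<infinity>" by auto
      then show ?thesis by (rule ereal_SUP[symmetric])
    qed
    finally show ?thesis using sup(2) by blast
  qed
  obtain q1 where q1: "q1 \<in> \<rat>" "(SUP l\<in>slice_of True ` strip. ereal (slice_weight l) * \<beta> l) = ereal q1"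
    using half by blast
  obtain q2 where q2: "q2 \<in> \<rat>" "(SUP l\<in>slice_of False ` strip. ereal (slice_weight l) * \<beta> l) = ereal q2"
    using half by blast
  have "(SUP l\<in>slices. ereal (slice_weight l) * \<beta> l) = ereal (max q1 q2)"
    unfolding slices_eq_slice_of SUP_union q1(2) q2(2) by (simp add: sup_max)
  moreover have "max q1 q2 \<in> \<rat>" using q1 q2 by (simp add: max_def)
  ultimately show ?thesis by blast
qed

section \<open>Rationality of the matching distance\<close>

theorem mainTheorem2:
  fixes M :: "(real \<times> real, 'k::{field, finite}, 'v) pmod"
    and N :: "(real \<times> real, 'k, 'w) pmod"
    and PM PN :: "(real \<times> real, 'k) presentation"
  assumes "persistence_module M" and "persistence_module N"
    and "presents PM M" and "presents PN N"
    and "\<forall>l \<in> slices. bottleneck_dist (slice_module M l) (slice_module N l) < \<infinity>"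
    and "\<forall>i < dim_row (pmat PM). row_gr PM i \<in> \<rat> \<times> \<rat>"
    and "\<forall>j < dim_col (pmat PM). col_gr PM j \<in> \<rat> \<times> \<rat>"
    and "\<forall>i < dim_row (pmat PN). row_gr PN i \<in> \<rat> \<times> \<rat>"
    and "\<forall>j < dim_col (pmat PN). col_gr PN j \<in> \<rat> \<times> \<rat>"
  shows "\<exists>q \<in> \<rat>. matching_dist M N = ereal q"
  unfolding matching_dist_def
proof (rule rational_SUP_slices)
  let ?G = "grades PM \<union> grades PN"
  show "finite ?G" by (simp add: grades_def)
  show "?G \<subseteq> \<rat> \<times> \<rat>" using assms(6-9) unfolding grades_def by blast
  fix l assume l: "l \<in> slices"
  show "\<exists>e\<in>cost_terms ?G. bottleneck_dist (slice_module M l) (slice_module N l) = ereal (e (push l)) \<and>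
      (\<forall>l'\<in>slices. same_order ?G (push l) (push l') \<longrightarrow>
         (\<forall>e'\<in>cost_terms ?G. e (push l) \<le> e' (push l) \<longrightarrow> e (push l') \<le> e' (push l')) \<longrightarrow>
         ereal (e (push l')) \<le> bottleneck_dist (slice_module M l') (slice_module N l'))"
    using bottleneck_slice_cell[OF assms(1,3,2,4) l] assms(5) l by (metis (no_types, lifting))
qed

end
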